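(* Let $p$ be a prime, $G$ a finite $p$-group, and $\mathcal{C}$ a $*$-covering of $G$. Then the ring $R_{\mathcal{C}}(G)$ is isomorphic to a direct product of rings each of which is either isomorphic to $M_2(\mathbb{Z}_p)$ or isomorphic to a ring of the form $S^{m+n}_{i_1,\ldots,i_n}(K_1,\ldots,K_m)$ (defined in the context) for some integers $m>0$, $n\ge 0$, indices $1\le i_1,\ldots,i_n\le m$, and subgroups $K_1,\ldots,K_m$ of $G$ of order $p$ (the data $m,n,i_j,K_i$ may vary from factor to factor).
   Context: Throughout, $\mathbb{Z}_k=\mathbb{Z}/k\mathbb{Z}$ and $M_2(\mathbb{Z}_p)$ is the ring of $2\times 2$ matrices over $\mathbb{Z}_p$. A cover of a group $G$ is a collection $\mathcal{C}$ of subgroups of $G$ with $\bigcup_{C\in\mathcal{C}}C=G$. A $*$-covering of a finite $p$-group $G$ is a cover $\mathcal{C}$ each of whose members is either a maximal cyclic subgroup of $G$ (a cyclic subgroup not properly contained in another cyclic subgroup of $G$) or an elementary abelian subgroup of order $p^2$. For a cover $\mathcal{C}$ by abelian subgroups, $R_{\mathcal{C}}(G)=\{f:G\to G \mid f|_C\in \mathrm{End}(C)\text{ for each }C\in\mathcal{C}\}$, where $f|_C\in\mathrm{End}(C)$ means that $f$ maps $C$ into $C$ and is a homomorphism on $C$. It is a ring under pointwise addition (using the group operation of $G$) and composition of functions. The ring $N^{m+n}_{i_1,\ldots,i_n}$: for integers $m>0$, $n\ge 0$ and $1\le i_1,\ldots,i_n\le m$, it is the ring of all $(m+n)\times(m+n)$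 matrices over $\mathbb{Z}_p$ of the block form $$\begin{bmatrix}\lambda I_m & J(\nu_1,\ldots,\nu_n)\\ 0 & D(\mu_1,\ldots,\mu_n)\end{bmatrix},\qquad \lambda,\nu_1,\ldots,\nu_n,\mu_1,\ldots,\mu_n\in\mathbb{Z}_p,$$ where $D(\mu_1,\ldots,\mu_n)$ is the diagonal matrix with diagonal entries $\mu_1,\ldots,\mu_n$, and $J(\nu_1,\ldots,\nu_n)$ is the $m\times n$ matrix with entry $\nu_j$ at position $(i_j,j)$ for $1\le j\le n$ and zeros elsewhere. The sets $R_{\Lambda(K),\lambda}$: let $K$ be a subgroup of $G$ of order $p$, let $M_1,\ldots,M_{\phi(K)}$ be the maximal cyclic subgroups of $G$ containing $K$, with $|M_i|=p^{n_i}$, and let $\Lambda(K)$ be the lattice of cyclic subgroups of $G$ containing $K$. For $\lambda\in\mathbb{Z}_p$, $R_{\Lambda(K),\lambda}$ is the set of tuples $\mathbf{x}=(\lambda_1,\ldots,\lambda_{\phi(K)})$ with $\lambda_i\in\mathbb{Z}_{p^{n_i}}$ such that the endomorphisms "multiplication by $\lambda_i$" (that is, $g\mapsto g^{\lambda_i}$) of the groups $M_i$ agree on the intersections $M_i\cap M_j$ for all $i,j$, and each restricts on $K$ to multiplication by $\lambda$. (If $K$ is itself a maximal cyclic subgroup, so that $\Lambda(K)=\{K\}$, then $R_{\Lambda(K),\lambda}=\{(\lambda)\}$.) The union $R_{\Lambda(K)}=\bigcup_{\lambda\in\mathbb{Z}_p}R_{\Lambda(K),\lambda}$ is a ring under componentwise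 operations. The ring $S^{m+n}_{i_1,\ldots,i_n}(K_1,\ldots,K_m)$: given subgroups $K_1,\ldots,K_m$ of $G$ of order $p$, it is the set of all arrays $$\left(\begin{bmatrix}\lambda I_m & J(\nu_1,\ldots,\nu_n)\\ 0 & D(\mu_1,\ldots,\mu_n)\end{bmatrix},\ \mathbf{x}_1,\ldots,\mathbf{x}_m,(\mu_1),\ldots,(\mu_n)\right)$$ with the matrix in $N^{m+n}_{i_1,\ldots,i_n}$ and $\mathbf{x}_i\in R_{\Lambda(K_i),\lambda}$ for $i=1,\ldots,m$ (with the same $\lambda$ as in the matrix). It is a ring under componentwise operations (a subdirect product of $N^{m+n}_{i_1,\ldots,i_n}$ and $R_{\Lambda(K_1)},\ldots,R_{\Lambda(K_m)}$). *)

theory Defs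
  imports
    "HOL-Algebra.Chinese_Remainder"
    "HOL-Algebra.Elementary_Groups"
    "HOL-Number_Theory.Residues"
    "Jordan_Normal_Form.Matrix"
begin

definition finite_p_group :: "nat \<Rightarrow> ('a, 'b) monoid_scheme \<Rightarrow> bool" where
  "finite_p_group p G \<longleftrightarrow> group G \<and> finite (carrier G) \<and> (\<exists>a. Coset.order G = p ^ a)"

definition cyclic_subgroup :: "'a set \<Rightarrow> ('a, 'b) monoid_scheme \<Rightarrow> bool" where
  "cyclic_subgroup H G \<longleftrightarrow> subgroup H G \<and> cyclic_group (G\<lparr>carrier := H\<rparr>)"

definition maximal_cyclic_subgroup :: "'a set \<Rightarrow> ('a, 'b) monoid_scheme \<Rightarrow> bool" where
  "maximal_cyclic_subgroup M G \<longleftrightarrow>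
     cyclic_subgroup M G \<and> (\<forall>H. cyclic_subgroup H G \<longrightarrow> \<not> M \<subset> H)"

definition elementary_abelian_subgroup ::
    "nat \<Rightarrow> 'a set \<Rightarrow> ('a, 'b) monoid_scheme \<Rightarrow> bool" where
  "elementary_abelian_subgroup p E G \<longleftrightarrow>
     subgroup E G \<and> comm_group (G\<lparr>carrier := E\<rparr>) \<and> (\<forall>x\<in>E. x [^]\<^bsub>G\<^esub> p = \<one>\<^bsub>G\<^esub>)"

definition group_cover :: "('a, 'b) monoid_scheme \<Rightarrow> 'a set set \<Rightarrow> bool" where
  "group_cover G \<C> \<longleftrightarrow> (\<forall>C\<in>\<C>. subgroup C G) \<and> \<Union>\<C> = carrier G"

definition star_covering :: "nat \<Rightarrow> ('a, 'b) monoid_scheme \<Rightarrow> 'a set set \<Rightarrow> bool" where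
  "star_covering p G \<C> \<longleftrightarrow> group_cover G \<C> \<and>
     (\<forall>C\<in>\<C>. maximal_cyclic_subgroup C G \<or>
             elementary_abelian_subgroup p C G \<and> card C = p\<^sup>2)"

text \<open>Functions on \<open>G\<close> are extensional on the carrier. The product is \<open>f \<circ> g\<close>, acting on the
  left. The operations yield a ring when the members of the cover are abelian.\<close>

definition cover_ring :: "('a, 'b) monoid_scheme \<Rightarrow> 'a set set \<Rightarrow> ('a \<Rightarrow> 'a) ring" where
  "cover_ring G \<C> =
     \<lparr>carrier = {f \<in> carrier G \<rightarrow>\<^sub>E carrier G. \<forall>C\<in>\<C>. f \<in> hom (G\<lparr>carrier := C\<rparr>) (G\<lparr>carrier := C\<rparr>)},
      monoid.mult = \<lambda>f g. compose (carrier G) f g,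
      one = \<lambda>x\<in>carrier G. x,
      zero = \<lambda>x\<in>carrier G. \<one>\<^bsub>G\<^esub>,
      add = \<lambda>f g. \<lambda>x\<in>carrier G. f x \<otimes>\<^bsub>G\<^esub> g x\<rparr>"

text \<open>\<open>n \<times> n\<close> matrices over a ring with explicit carrier; \<open>ring_mat\<close> covers only
  rings given by a type class.\<close>

definition matrix_ring :: "('a, 'b) ring_scheme \<Rightarrow> nat \<Rightarrow> 'a mat ring" where
  "matrix_ring R n =
     \<lparr>carrier = {A \<in> carrier_mat n n. \<forall>i<n. \<forall>j<n. A $$ (i, j) \<in> carrier R},
      monoid.mult = \<lambda>A B. mat n n (\<lambda>(i, j). \<Oplus>\<^bsub>R\<^esub>k\<in>{..<n}. A $$ (i, k) \<otimes>\<^bsub>R\<^esub> B $$ (k, j)),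
      one = mat n n (\<lambda>(i, j). if i = j then \<one>\<^bsub>R\<^esub> else \<zero>\<^bsub>R\<^esub>),
      zero = mat n n (\<lambda>_. \<zero>\<^bsub>R\<^esub>),
      add = \<lambda>A B. mat n n (\<lambda>(i, j). A $$ (i, j) \<oplus>\<^bsub>R\<^esub> B $$ (i, j))\<rparr>"

text \<open>\<open>\<int>\<^sub>k\<close> is \<open>residue_ring k\<close>, whose elements are the integers \<open>0, \<dots>, k - 1\<close>. The list \<open>idx\<close>
  holds \<open>i\<^sub>1, \<dots>, i\<^sub>n\<close>, with \<open>1 \<le> i\<^sub>j \<le> m\<close>, whereas matrix and list positions are counted from 0:
  \<open>\<nu>\<^sub>j\<close> sits in row \<open>i\<^sub>j - 1\<close>.\<close>

definition N_mat :: "nat \<Rightarrow> nat list \<Rightarrow> int \<Rightarrow> int list \<Rightarrow> int list \<Rightarrow> int mat" where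
  "N_mat m idx l \<nu> \<mu> = (let n = length idx in
     four_block_mat
       (l \<cdot>\<^sub>m 1\<^sub>m m) (mat m n (\<lambda>(i, j). if Suc i = idx ! j then \<nu> ! j else 0))
       (0\<^sub>m n m)     (mat_diag n (\<lambda>j. \<mu> ! j)))"

definition N_ring :: "nat \<Rightarrow> nat \<Rightarrow> nat list \<Rightarrow> int mat ring" where
  "N_ring p m idx = (matrix_ring (residue_ring p) (m + length idx))
     \<lparr>carrier := {N_mat m idx l \<nu> \<mu> | l \<nu> \<mu>. l \<in> carrier (residue_ring p) \<and>
        length \<nu> = length idx \<and> set \<nu> \<subseteq> carrier (residue_ring p) \<and>
        length \<mu> = length idx \<and> set \<mu> \<subseteq> carrier (residue_ring p)}\<rparr>"

definition maximal_cyclics_over :: "('a, 'b) monoid_scheme \<Rightarrow> 'a set \<Rightarrow> 'a set set" where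
  "maximal_cyclics_over G K = {M. maximal_cyclic_subgroup M G \<and> K \<subseteq> M}"

text \<open>The tuples \<open>(\<lambda>\<^sub>1, \<dots>, \<lambda>\<^sub>\<phi>)\<close> are indexed by the maximal cyclic subgroups \<open>M\<close> containing \<open>K\<close>
  themselves instead of by a numbering of them.\<close>

definition R_Lambda_at :: "('a, 'b) monoid_scheme \<Rightarrow> 'a set \<Rightarrow> int \<Rightarrow> ('a set \<Rightarrow> int) set" where
  "R_Lambda_at G K l =
     {x \<in> (\<Pi>\<^sub>E M\<in>maximal_cyclics_over G K. carrier (residue_ring (card M))).
        (\<forall>M\<in>maximal_cyclics_over G K. \<forall>M'\<in>maximal_cyclics_over G K. \<forall>g\<in>M \<inter> M'.
           g [^]\<^bsub>G\<^esub> x M = g [^]\<^bsub>G\<^esub> x M') \<and>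
        (\<forall>M\<in>maximal_cyclics_over G K. \<forall>g\<in>K. g [^]\<^bsub>G\<^esub> x M = g [^]\<^bsub>G\<^esub> l)}"

definition R_Lambda :: "nat \<Rightarrow> ('a, 'b) monoid_scheme \<Rightarrow> 'a set \<Rightarrow> ('a set \<Rightarrow> int) ring" where
  "R_Lambda p G K =
     \<lparr>carrier = (\<Union>l\<in>carrier (residue_ring p). R_Lambda_at G K l),
      monoid.mult = \<lambda>x y. \<lambda>M\<in>maximal_cyclics_over G K. x M \<otimes>\<^bsub>residue_ring (card M)\<^esub> y M,
      one = \<lambda>M\<in>maximal_cyclics_over G K. \<one>\<^bsub>residue_ring (card M)\<^esub>,
      zero = \<lambda>M\<in>maximal_cyclics_over G K. \<zero>\<^bsub>residue_ring (card M)\<^esub>,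
      add = \<lambda>x y. \<lambda>M\<in>maximal_cyclics_over G K. x M \<oplus>\<^bsub>residue_ring (card M)\<^esub> y M\<rparr>"

text \<open>The subring of \<open>N \<times> (R\<^bsub>\<Lambda>(K\<^sub>1)\<^esub> \<times> \<dots> \<times> R\<^bsub>\<Lambda>(K\<^sub>m)\<^esub>) \<times> \<int>\<^sub>p\<^sup>n\<close> whose components share
  \<open>\<lambda>\<close> and \<open>\<mu>\<^sub>1, \<dots>, \<mu>\<^sub>n\<close>; here \<open>m = length Ks\<close> and \<open>n = length idx\<close>.\<close>

definition S_ring :: "nat \<Rightarrow> ('a, 'b) monoid_scheme \<Rightarrow> nat list \<Rightarrow> 'a set list \<Rightarrow>
    (int mat \<times> ('a set \<Rightarrow> int) list \<times> int list) ring" where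
  "S_ring p G idx Ks =
     (RDirProd (N_ring p (length Ks) idx)
       (RDirProd (RDirProd_list (map (R_Lambda p G) Ks))
                 (RDirProd_list (replicate (length idx) (residue_ring p)))))
     \<lparr>carrier := {(N_mat (length Ks) idx l \<nu> \<mu>, xs, \<mu>) | l \<nu> \<mu> xs.
        l \<in> carrier (residue_ring p) \<and>
        length \<nu> = length idx \<and> set \<nu> \<subseteq> carrier (residue_ring p) \<and>
        length \<mu> = length idx \<and> set \<mu> \<subseteq> carrier (residue_ring p) \<and>
        length xs = length Ks \<and> (\<forall>i<length Ks. xs ! i \<in> R_Lambda_at G (Ks ! i) l)}\<rparr>"

end

theory Submission
  imports Defs
begin

text \<open>
  Call a subgroup of order \<open>p\<close> a point if it lies in a cyclic member of the cover or in two elementary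
  abelian members. Every element of \<open>R\<close> maps each point into itself. An elementary abelian member \<open>E\<close>
  without points carries an unrestricted endomorphism, so it contributes a factor \<open>M\<^sub>2(\<int>\<^sub>p)\<close>. With exactly
  one point, the endomorphism of \<open>E\<close> is upper triangular with the eigenvalue \<open>\<lambda>\<close> of that point; this is a
  pair \<open>(\<nu>\<^sub>j, \<mu>\<^sub>j)\<close>. With exactly two points it is determined by two independent eigenvalues, and with
  three or more it is a scalar, which forces the eigenvalues of its points to agree. The equivalence
  classes of points generated by the last case are the sets \<open>{K\<^sub>1, \<dots>, K\<^sub>m}\<close>, and endomorphisms of the
  members that agree on the points and on intersections of cyclic members can be chosen independently
  for different classes and glued.
\<close>

section \<open>Direct products of lists of rings\<close>

text \<open>The tuples in R_Lambda run over all maximal cyclic subgroups of G above K, whereas the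
  cover may contain only some of them. A maximal cyclic subgroup that is not a member lies in an
  elementary abelian member, so above a point K it can only be K itself, where the action is already
  known. Two cyclic members may meet in more than a point; in every other pair of distinct members
  each common element except the identity lies in a common point. So agreement on whole
  intersections matters only among maximal cyclic subgroups above one point, and elsewhere it is a
  statement about eigenvalues. No global isomorphism is written down. Each factor comes with a
  support, a subset of G, and a homomorphism whose kernel consists of the functions trivial on the
  support and whose values are all attained by functions trivial on the other supports. Elementary
  abelian members with at least two points contribute to no support: their points span them, and if
  there are exactly two, these can lie in different classes. The factors have elements of different
  types. Being finite, they are recoded on natural numbers so that one list can hold them.\<close>

lemma
  fixes F :: "'i \<Rightarrow> ('a, 'b) ring_scheme"
  assumes "\<And>i. i \<in> set is \<Longrightarrow> a i \<in> carrier (F i)" "\<And>i. i \<in> set is \<Longrightarrow> b i \<in> carrier (F i)"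
  shows RDirProd_list_mult: "map a is \<otimes>\<^bsub>RDirProd_list (map F is)\<^esub> map b is = map (\<lambda>i. a i \<otimes>\<^bsub>F i\<^esub> b i) is"
    and RDirProd_list_add: "map a is \<oplus>\<^bsub>RDirProd_list (map F is)\<^esub> map b is = map (\<lambda>i. a i \<oplus>\<^bsub>F i\<^esub> b i) is"
proof -
  have "map a is \<otimes>\<^bsub>RDirProd_list (map F is)\<^esub> map b is = map (\<lambda>i. a i \<otimes>\<^bsub>F i\<^esub> b i) is \<and>
     map a is \<oplus>\<^bsub>RDirProd_list (map F is)\<^esub> map b is = map (\<lambda>i. a i \<oplus>\<^bsub>F i\<^esub> b i) is"
    using assms
  proof (induction "is")
    case Nil
    then show ?case by (simp add: monoid.defs)
  next
    case (Cons i "is")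
    \<comment> \<open>Prepending an entry is a homomorphism from the binary product, which yields
      the operations on the longer list.\<close>
    have h: "(\<lambda>(a, as). a # as) \<in> Ring.ring_hom (RDirProd (F i) (RDirProd_list (map F is))) (RDirProd_list (F i # map F is))"
      by (rule RDirProd_list_hom1)
    have c: "(a i, map a is) \<in> carrier (RDirProd (F i) (RDirProd_list (map F is)))"
        "(b i, map b is) \<in> carrier (RDirProd (F i) (RDirProd_list (map F is)))"
      using Cons.prems by (auto simp: RDirProd_carrier intro!: RDirProd_list_carrier_memI)
    show ?case
      using ring_hom_mult[OF h c] ring_hom_add[OF h c] Cons
      by (simp add: RDirProd_def DirProd_def monoid.defs)
  qed
  then show "map a is \<otimes>\<^bsub>RDirProd_list (map F is)\<^esub> map b is = map (\<lambda>i. a i \<otimes>\<^bsub>F i\<^esub> b i) is"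
    "map a is \<oplus>\<^bsub>RDirProd_list (map F is)\<^esub> map b is = map (\<lambda>i. a i \<oplus>\<^bsub>F i\<^esub> b i) is" by auto
qed

lemma RDirProd_list_one_map: "\<one>\<^bsub>RDirProd_list (map F is)\<^esub> = map (\<lambda>i. \<one>\<^bsub>F i\<^esub>) is"
  by (induction "is") (simp_all add: RDirProd_list_one monoid.defs)

text \<open>Differences reduce injectivity to \<open>ker\<close>. A tuple is reached by summing
  elements that each hit one entry and vanish at the others. Distinct indices may share a ring, and
  the conclusion records only which rings occur.\<close>

lemma ring_iso_RDirProd_list:
  fixes R :: "('a, 'b) ring_scheme" and F :: "'i \<Rightarrow> ('c, 'd) ring_scheme"
  assumes R: "ring R" and fin: "finite I"
    and F: "\<And>i. i \<in> I \<Longrightarrow> ring (F i)"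
    and h: "\<And>i. i \<in> I \<Longrightarrow> h i \<in> Ring.ring_hom R (F i)"
    and ker: "\<And>r. r \<in> carrier R \<Longrightarrow> (\<And>i. i \<in> I \<Longrightarrow> h i r = \<zero>\<^bsub>F i\<^esub>) \<Longrightarrow> r = \<zero>\<^bsub>R\<^esub>"
    and surj: "\<And>i y. i \<in> I \<Longrightarrow> y \<in> carrier (F i) \<Longrightarrow>
       \<exists>r\<in>carrier R. h i r = y \<and> (\<forall>j\<in>I - {i}. h j r = \<zero>\<^bsub>F j\<^esub>)"
  shows "\<exists>Fs. set Fs = F ` I \<and> R \<simeq> RDirProd_list Fs"
proof -
  interpret R: ring R by fact
  obtain "is" where is_: "set is = I" "distinct is"
    using fin finite_distinct_list by blast
  \<comment> \<open>Induction on the set \<open>J\<close> of entries already prescribed: a new entry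
    is set by adding an element that vanishes at all other indices.\<close>
  have glue: "\<exists>r\<in>carrier R. \<forall>i\<in>I. h i r = (if i \<in> J then y i else \<zero>\<^bsub>F i\<^esub>)"
    if "finite J" "J \<subseteq> I" "\<And>i. i \<in> I \<Longrightarrow> y i \<in> carrier (F i)" for J y
    using that
  proof (induction J rule: finite_induct)
    case empty
    have "h i \<zero>\<^bsub>R\<^esub> = \<zero>\<^bsub>F i\<^esub>" if "i \<in> I" for i
      using ring_hom_zero[OF h R F] that by blast
    then show ?case by auto
  next
    case (insert j J)
    then obtain r where r: "r \<in> carrier R" "\<forall>i\<in>I. h i r = (if i \<in> J then y i else \<zero>\<^bsub>F i\<^esub>)"
      by auto
    obtain s where s: "s \<in> carrier R" "h j s = y j" "\<forall>i\<in>I - {j}. h i s = \<zero>\<^bsub>F i\<^esub>"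
      using surj[of j "y j"] insert by auto
    have "h i (r \<oplus>\<^bsub>R\<^esub> s) = (if i \<in> insert j J then y i else \<zero>\<^bsub>F i\<^esub>)" if i: "i \<in> I" for i
    proof -
      interpret Fi: ring "F i" using F i by blast
      have e: "h i (r \<oplus>\<^bsub>R\<^esub> s) = h i r \<oplus>\<^bsub>F i\<^esub> h i s" using ring_hom_add[OF h[OF i]] r s by blast
      show ?thesis
      proof (cases "i = j")
        case True
        then have "h i r = \<zero>\<^bsub>F i\<^esub>" "h i s = y i" "y i \<in> carrier (F i)"
          using r s insert i ring_hom_closed[OF h[OF i] s(1)] by auto
        then show ?thesis by (simp add: e) (simp add: True)
      next
        case False
        then show ?thesis using e r s insert i by (auto)
      qed
    qed
    then show ?case using r s by (intro bexI[of _ "r \<oplus>\<^bsub>R\<^esub> s"]) auto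
  qed
  let ?Fs = "map F is" and ?h = "\<lambda>r. map (\<lambda>i. h i r) is"
  have hc: "h i r \<in> carrier (F i)" if "i \<in> set is" "r \<in> carrier R" for i r
    using ring_hom_closed[OF h] that is_ by blast
  have "?h \<in> ring_iso R (RDirProd_list ?Fs)"
  proof (rule ring_iso_memI)
    fix r assume r: "r \<in> carrier R"
    show "?h r \<in> carrier (RDirProd_list ?Fs)"
      using hc r by (auto intro!: RDirProd_list_carrier_memI)
    fix s assume s: "s \<in> carrier R"
    show "?h (r \<otimes>\<^bsub>R\<^esub> s) = ?h r \<otimes>\<^bsub>RDirProd_list ?Fs\<^esub> ?h s"
      by (subst RDirProd_list_mult) (use hc r s ring_hom_mult[OF h] is_ in auto)
    show "?h (r \<oplus>\<^bsub>R\<^esub> s) = ?h r \<oplus>\<^bsub>RDirProd_list ?Fs\<^esub> ?h s"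
      by (subst RDirProd_list_add) (use hc r s ring_hom_add[OF h] is_ in auto)
  next
    show "?h \<one>\<^bsub>R\<^esub> = \<one>\<^bsub>RDirProd_list ?Fs\<^esub>"
      unfolding RDirProd_list_one_map using ring_hom_one[OF h] is_ by auto
  next
    show "bij_betw ?h (carrier R) (carrier (RDirProd_list ?Fs))"
      unfolding bij_betw_def
    proof
      show "inj_on ?h (carrier R)"
      proof (rule inj_onI)
        fix r s assume rs: "r \<in> carrier R" "s \<in> carrier R" "?h r = ?h s"
        have "r \<ominus>\<^bsub>R\<^esub> s = \<zero>\<^bsub>R\<^esub>"
        proof (rule ker)
          fix i assume i: "i \<in> I"
          then have e: "h i r = h i s" using rs is_ by auto
          interpret Fi: ring "F i" using F i by blast
          interpret hi: ring_hom_ring R "F i" "h i"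
            using h i R by (intro ring_hom_ringI2) (auto intro: Fi.ring_axioms)
          have "h i (r \<ominus>\<^bsub>R\<^esub> s) = h i r \<oplus>\<^bsub>F i\<^esub> (\<ominus>\<^bsub>F i\<^esub> h i s)"
            using rs by (simp add: R.minus_eq)
          then show "h i (r \<ominus>\<^bsub>R\<^esub> s) = \<zero>\<^bsub>F i\<^esub>"
            using e rs by (simp add: Fi.r_neg)
        qed (use rs in auto)
        then show "r = s" using rs by simp
      qed
      show "?h ` carrier R = carrier (RDirProd_list ?Fs)"
      proof (intro equalityI subsetI)
        fix ys assume "ys \<in> carrier (RDirProd_list ?Fs)"
        note ys = RDirProd_list_carrier_mem[OF this]
        \<comment> \<open>Reads the list as a family over \<open>I\<close>. As \<open>is\<close> has
          no repetitions, the chosen position is the only one.\<close>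
        define y where "y i = ys ! (SOME n. n < length is \<and> is ! n = i)" for i
        have yn: "y (is ! n) = ys ! n" if "n < length is" for n
        proof -
          have "(SOME k. k < length is \<and> is ! k = is ! n) = n"
            using that is_ by (intro some_equality) (auto simp: nth_eq_iff_index_eq)
          then show ?thesis by (simp add: y_def)
        qed
        have "y i \<in> carrier (F i)" if "i \<in> I" for i
          using that yn ys is_ by (metis in_set_conv_nth length_map nth_map)
        then obtain r where r: "r \<in> carrier R" "\<forall>i\<in>I. h i r = y i"
          using glue[of I y] fin by auto
        have "?h r = ys"
          by (rule nth_equalityI) (use r ys yn is_ in auto)
        then show "ys \<in> ?h ` carrier R" using r by auto
      qed (use hc in \<open>auto intro!: RDirProd_list_carrier_memI\<close>)
    qed
  qed
  then show ?thesis using is_ unfolding is_ring_iso_def by (intro exI[of _ ?Fs]) auto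
qed

text \<open>Brings all factors to a single element type. The ring axioms are not assumed for
  \<open>T\<close>: the copy inherits them from \<open>R\<close>, of which it is a homomorphic
  image. The last clause lets statements about values of \<open>h\<close> be carried over to
  \<open>k\<close>.\<close>

lemma ring_hom_countable_image:
  fixes R :: "('a, 'b) ring_scheme" and T :: "('c, 'd) ring_scheme"
  assumes R: "ring R" and h: "h \<in> Ring.ring_hom R T" and onto: "h ` carrier R = carrier T"
    and fin: "finite (carrier R)"
  shows "\<exists>(F :: nat ring) k. ring F \<and> k \<in> Ring.ring_hom R F \<and> k ` carrier R = carrier F \<and> F \<simeq> T \<and>
    (\<forall>r\<in>carrier R. \<forall>s\<in>carrier R. k r = k s \<longleftrightarrow> h r = h s)"
proof -
  interpret R: ring R by fact
  have finT: "finite (carrier T)" using fin onto by (metis finite_imageI)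
  then obtain e :: "'c \<Rightarrow> nat" where e: "inj_on e (carrier T)"
    using finite_imp_inj_to_nat_seg by blast
  define d where "d = inv_into (carrier T) e"
  have d: "d (e x) = x" if "x \<in> carrier T" for x
    using that e by (simp add: d_def)
  \<comment> \<open>The zero of \<open>T\<close> is not known to be the image of zero, so the zero
    of the copy is the code of that image.\<close>
  define F0 :: "nat ring" where "F0 = \<lparr>carrier = e ` carrier T,
     monoid.mult = \<lambda>a b. e (d a \<otimes>\<^bsub>T\<^esub> d b), one = e \<one>\<^bsub>T\<^esub>,
     zero = e (h \<zero>\<^bsub>R\<^esub>), add = \<lambda>a b. e (d a \<oplus>\<^bsub>T\<^esub> d b)\<rparr>"
  have hc: "h r \<in> carrier T" if "r \<in> carrier R" for r using onto that by blast
  have k: "(\<lambda>r. e (h r)) \<in> Ring.ring_hom R F0"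
    using hc ring_hom_mult[OF h] ring_hom_add[OF h] ring_hom_one[OF h]
    by (auto intro!: ring_hom_memI simp: F0_def d)
  have im: "(\<lambda>r. e (h r)) ` carrier R = carrier F0"
    using image_image[of e h "carrier R"] onto by (simp add: F0_def)
  have "ring (F0\<lparr>carrier := carrier F0, zero := e (h \<zero>\<^bsub>R\<^esub>)\<rparr>)"
    using R.ring_hom_imp_img_ring[OF k] im by simp
  then have F0: "ring F0" by (simp add: F0_def)
  have cl: "x \<otimes>\<^bsub>T\<^esub> y \<in> carrier T" "x \<oplus>\<^bsub>T\<^esub> y \<in> carrier T" if "x \<in> carrier T" "y \<in> carrier T" for x y
  proof -
    have "x \<in> h ` carrier R" "y \<in> h ` carrier R" using that onto by auto
    then obtain r s where "r \<in> carrier R" "s \<in> carrier R" "x = h r" "y = h s" by (elim imageE) simp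
    then show "x \<otimes>\<^bsub>T\<^esub> y \<in> carrier T" "x \<oplus>\<^bsub>T\<^esub> y \<in> carrier T"
      using ring_hom_mult[OF h, of r s] ring_hom_add[OF h, of r s] hc[of "r \<otimes>\<^bsub>R\<^esub> s"] hc[of "r \<oplus>\<^bsub>R\<^esub> s"] by auto
  qed
  have "\<one>\<^bsub>T\<^esub> \<in> carrier T" using hc[OF R.one_closed] ring_hom_one[OF h] by simp
  then have "d \<in> ring_iso F0 T"
    using cl by (intro ring_iso_memI bij_betw_byWitness[where f' = e]) (auto simp: F0_def d)
  then have "F0 \<simeq> T" by (auto simp: is_ring_iso_def)
  moreover have "\<forall>r\<in>carrier R. \<forall>s\<in>carrier R. e (h r) = e (h s) \<longleftrightarrow> h r = h s"
    using e hc by (auto simp: inj_on_def)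
  ultimately show ?thesis using F0 k im by blast
qed

section \<open>Matrix rings over residue rings\<close>

lemma residue_ring_simps [simp]:
  "carrier (residue_ring m) = {0..<m}"
  "x \<otimes>\<^bsub>residue_ring m\<^esub> y = (x * y) mod m" "x \<oplus>\<^bsub>residue_ring m\<^esub> y = (x + y) mod m"
  "\<one>\<^bsub>residue_ring m\<^esub> = 1" "\<zero>\<^bsub>residue_ring m\<^esub> = 0"
  by (auto simp: residue_ring_def)

lemma finsum_residue_ring:
  assumes "1 < m" "finite A"
  shows "(\<Oplus>\<^bsub>residue_ring m\<^esub>k\<in>A. f k mod m) = (\<Sum>k\<in>A. f k) mod m"
proof -
  interpret residues m "residue_ring m" by unfold_locales (use assms in auto)
  show ?thesis using assms(2)
  proof (induction A rule: finite_induct)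
    case (insert x A)
    then show ?case using assms(1) by (subst finsum_insert) (auto simp: mod_simps)
  qed simp
qed

text \<open>Lets products be computed with integer matrices, where block formulas apply, with a
  single reduction of the entries at the end.\<close>

lemma matrix_ring_mult:
  assumes "1 < m" "A \<in> carrier_mat n n" "B \<in> carrier_mat n n"
  shows "A \<otimes>\<^bsub>matrix_ring (residue_ring m) n\<^esub> B = map_mat (\<lambda>x. x mod m) (A * B)"
  using assms
  by (intro eq_matI) (auto simp: matrix_ring_def finsum_residue_ring scalar_prod_def lessThan_atLeast0)

lemma matrix_ring_add:
  assumes "A \<in> carrier_mat n n" "B \<in> carrier_mat n n"
  shows "A \<oplus>\<^bsub>matrix_ring (residue_ring m) n\<^esub> B = map_mat (\<lambda>x. x mod m) (A + B)"
  using assms by (intro eq_matI) (auto simp: matrix_ring_def)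

lemma N_mat_carrier [simp]: "N_mat m idx l \<nu> \<mu> \<in> carrier_mat (m + length idx) (m + length idx)"
  by (simp add: N_mat_def Let_def mat_diag_def)

lemma N_mat_dim [simp]:
  "dim_row (N_mat m idx l \<nu> \<mu>) = m + length idx" "dim_col (N_mat m idx l \<nu> \<mu>) = m + length idx"
  using N_mat_carrier[of m idx l \<nu> \<mu>] by (auto simp only: carrier_mat_def)

lemma N_mat_index:
  assumes "i < m + length idx" "j < m + length idx"
  shows "N_mat m idx l \<nu> \<mu> $$ (i, j) =
    (if i < m then (if j < m then (if i = j then l else 0)
       else if Suc i = idx ! (j - m) then \<nu> ! (j - m) else 0)
     else if i = j then \<mu> ! (j - m) else 0)"
  using assms by (auto simp: N_mat_def Let_def mat_diag_def)

lemma N_mat_map: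
  assumes "g 0 = 0" "length \<nu> = length idx" "length \<mu> = length idx"
  shows "map_mat g (N_mat m idx l \<nu> \<mu>) = N_mat m idx (g l) (map g \<nu>) (map g \<mu>)"
  using assms by (intro eq_matI) (auto simp: N_mat_index)

lemma N_mat_add:
  "N_mat m (map d js) l (map a js) (map b js) + N_mat m (map d js) l' (map a' js) (map b' js) =
   N_mat m (map d js) (l + l') (map (\<lambda>j. a j + a' j) js) (map (\<lambda>j. b j + b' j) js)"
  by (intro eq_matI) (auto simp: N_mat_index)

text \<open>In blocks, the upper right corner of the product is l J' + J D'. A scalar keeps the zero
  pattern of J', and a diagonal matrix on the right only scales the columns of J, so the shape
  survives multiplication. Entries are functions on a common list \<open>js\<close>, which keeps the
  rows prescribed by \<open>d\<close> fixed.\<close>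

lemma N_mat_mult:
  fixes d :: "'j \<Rightarrow> nat"
  shows "N_mat m (map d js) l (map a js) (map b js) * N_mat m (map d js) l' (map a' js) (map b' js) =
   N_mat m (map d js) (l * l') (map (\<lambda>j. l * a' j + a j * b' j) js) (map (\<lambda>j. b j * b' j) js)"
proof -
  let ?n = "length js"
  let ?J = "\<lambda>v. mat m ?n (\<lambda>(i, j). if Suc i = d (js ! j) then v (js ! j) else 0 :: int)"
  let ?D = "\<lambda>v. mat_diag ?n (\<lambda>j. v (js ! j)) :: int mat"
  have N: "N_mat m (map d js) l (map a js) (map b js) =
      four_block_mat (l \<cdot>\<^sub>m 1\<^sub>m m) (?J a) (0\<^sub>m ?n m) (?D b)" for l a b
    by (intro eq_matI) (auto simp: N_mat_def Let_def mat_diag_def)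
  have D: "?D v \<in> carrier_mat ?n ?n" for v by (simp add: mat_diag_def)
  have JD: "?J a * ?D b' = ?J (\<lambda>j. a j * b' j)"
    by (subst mat_diag_mult_right[of _ m]) (auto intro!: eq_matI)
  have lJ: "(l \<cdot>\<^sub>m 1\<^sub>m m) * ?J a' = ?J (\<lambda>j. l * a' j)"
    by (subst mult_smult_assoc_mat[of _ m m _ ?n]) (auto intro!: eq_matI)
  have ll: "(l \<cdot>\<^sub>m 1\<^sub>m m) * (l' \<cdot>\<^sub>m 1\<^sub>m m) = ((l * l') \<cdot>\<^sub>m 1\<^sub>m m :: int mat)"
    by (subst mult_smult_assoc_mat[of _ m m _ m]) (auto intro!: eq_matI)
  have DD: "?D b * ?D b' = ?D (\<lambda>j. b j * b' j)" by (simp add: mat_diag_diag)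
  have "four_block_mat (l \<cdot>\<^sub>m 1\<^sub>m m) (?J a) (0\<^sub>m ?n m) (?D b) *
      four_block_mat (l' \<cdot>\<^sub>m 1\<^sub>m m) (?J a') (0\<^sub>m ?n m) (?D b') =
    four_block_mat ((l \<cdot>\<^sub>m 1\<^sub>m m) * (l' \<cdot>\<^sub>m 1\<^sub>m m) + ?J a * 0\<^sub>m ?n m) ((l \<cdot>\<^sub>m 1\<^sub>m m) * ?J a' + ?J a * ?D b')
      (0\<^sub>m ?n m * (l' \<cdot>\<^sub>m 1\<^sub>m m) + ?D b * 0\<^sub>m ?n m) (0\<^sub>m ?n m * ?J a' + ?D b * ?D b')"
    by (rule mult_four_block_mat) (auto simp: D)
  also have "\<dots> = four_block_mat ((l * l') \<cdot>\<^sub>m 1\<^sub>m m) (?J (\<lambda>j. l * a' j + a j * b' j)) (0\<^sub>m ?n m) (?D (\<lambda>j. b j * b' j))"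
  proof -
    have "(l * l') \<cdot>\<^sub>m 1\<^sub>m m + ?J a * 0\<^sub>m ?n m = (l * l') \<cdot>\<^sub>m 1\<^sub>m m" by (subst right_mult_zero_mat) (auto intro!: eq_matI)
    moreover have "?J (\<lambda>j. l * a' j) + ?J (\<lambda>j. a j * b' j) = ?J (\<lambda>j. l * a' j + a j * b' j)" by (auto intro!: eq_matI)
    moreover have "0\<^sub>m ?n m * (l' \<cdot>\<^sub>m 1\<^sub>m m) + ?D b * 0\<^sub>m ?n m = 0\<^sub>m ?n m"
      using D[of b] by (simp add: left_mult_zero_mat[of _ m m] right_mult_zero_mat[OF D])
    moreover have "0\<^sub>m ?n m * ?J a' + ?D (\<lambda>j. b j * b' j) = ?D (\<lambda>j. b j * b' j)"
      using D by (subst left_mult_zero_mat[of _ m ?n]) auto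
    ultimately show ?thesis by (simp only: ll lJ JD DD)
  qed
  finally show ?thesis by (simp only: N)
qed

lemma N_mat_one: "N_mat m idx 1 (map (\<lambda>_. 0) idx) (map (\<lambda>_. 1) idx) = 1\<^sub>m (m + length idx)"
  by (intro eq_matI) (auto simp: N_mat_index)

lemma matrix_ring_one: "\<one>\<^bsub>matrix_ring (residue_ring m) n\<^esub> = 1\<^sub>m n"
  by (intro eq_matI) (auto simp: matrix_ring_def)

lemma
  shows S_ring_mult: "(A, xs, \<mu>) \<otimes>\<^bsub>S_ring p G idx Ks\<^esub> (B, ys, \<mu>') =
      (A \<otimes>\<^bsub>matrix_ring (residue_ring (int p)) (length Ks + length idx)\<^esub> B,
       xs \<otimes>\<^bsub>RDirProd_list (map (R_Lambda p G) Ks)\<^esub> ys,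
       \<mu> \<otimes>\<^bsub>RDirProd_list (replicate (length idx) (residue_ring (int p)))\<^esub> \<mu>')"
    and S_ring_add: "(A, xs, \<mu>) \<oplus>\<^bsub>S_ring p G idx Ks\<^esub> (B, ys, \<mu>') =
      (A \<oplus>\<^bsub>matrix_ring (residue_ring (int p)) (length Ks + length idx)\<^esub> B,
       xs \<oplus>\<^bsub>RDirProd_list (map (R_Lambda p G) Ks)\<^esub> ys,
       \<mu> \<oplus>\<^bsub>RDirProd_list (replicate (length idx) (residue_ring (int p)))\<^esub> \<mu>')"
    and S_ring_one: "\<one>\<^bsub>S_ring p G idx Ks\<^esub> =
      (1\<^sub>m (length Ks + length idx), \<one>\<^bsub>RDirProd_list (map (R_Lambda p G) Ks)\<^esub>,
       \<one>\<^bsub>RDirProd_list (replicate (length idx) (residue_ring (int p)))\<^esub>)"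
  by (simp_all add: S_ring_def N_ring_def RDirProd_def DirProd_def monoid.defs matrix_ring_one)

lemma
  shows R_Lambda_mult: "x \<otimes>\<^bsub>R_Lambda p G K\<^esub> y = (\<lambda>M\<in>maximal_cyclics_over G K. (x M * y M) mod int (card M))"
    and R_Lambda_add: "x \<oplus>\<^bsub>R_Lambda p G K\<^esub> y = (\<lambda>M\<in>maximal_cyclics_over G K. (x M + y M) mod int (card M))"
    and R_Lambda_one: "\<one>\<^bsub>R_Lambda p G K\<^esub> = (\<lambda>M\<in>maximal_cyclics_over G K. 1)"
  by (simp_all add: R_Lambda_def)

lemma S_ring_carrier:
  "carrier (S_ring p G idx Ks) = {(N_mat (length Ks) idx l \<nu> \<mu>, xs, \<mu>) | l \<nu> \<mu> xs.
        l \<in> carrier (residue_ring p) \<and>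
        length \<nu> = length idx \<and> set \<nu> \<subseteq> carrier (residue_ring p) \<and>
        length \<mu> = length idx \<and> set \<mu> \<subseteq> carrier (residue_ring p) \<and>
        length xs = length Ks \<and> (\<forall>i<length Ks. xs ! i \<in> R_Lambda_at G (Ks ! i) l)}"
  by (simp add: S_ring_def)

lemma S_ring_memI:
  assumes "l \<in> carrier (residue_ring p)" "length \<nu> = length idx" "set \<nu> \<subseteq> carrier (residue_ring p)"
    "length \<mu> = length idx" "set \<mu> \<subseteq> carrier (residue_ring p)" "length xs = length Ks"
    "\<And>i. i < length Ks \<Longrightarrow> xs ! i \<in> R_Lambda_at G (Ks ! i) l"
  shows "(N_mat (length Ks) idx l \<nu> \<mu>, xs, \<mu>) \<in> carrier (S_ring p G idx Ks)"
  using assms unfolding S_ring_carrier by blast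

section \<open>Endomorphisms of subgroups of a finite p-group\<close>

context group
begin

definition endo_on :: "'a set \<Rightarrow> ('a \<Rightarrow> 'a) \<Rightarrow> bool" where
  "endo_on H f \<longleftrightarrow> f \<in> hom (G\<lparr>carrier := H\<rparr>) (G\<lparr>carrier := H\<rparr>)"

lemma endo_on_iff:
  "endo_on H f \<longleftrightarrow> (\<forall>x\<in>H. f x \<in> H) \<and> (\<forall>x\<in>H. \<forall>y\<in>H. f (x \<otimes> y) = f x \<otimes> f y)"
  by (auto simp: endo_on_def hom_def)

lemma endo_on_group_hom:
  assumes "subgroup H G" "endo_on H f"
  shows "group_hom (G\<lparr>carrier := H\<rparr>) (G\<lparr>carrier := H\<rparr>) f"
  using assms by (auto simp: group_hom_def group_hom_axioms_def endo_on_def subgroup.subgroup_is_group)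

lemma endo_on_one: "subgroup H G \<Longrightarrow> endo_on H f \<Longrightarrow> f \<one> = \<one>"
  using group_hom.hom_one[OF endo_on_group_hom] by fastforce

lemma endo_on_int_pow:
  assumes "subgroup H G" "endo_on H f" "x \<in> H"
  shows "f (x [^] (i::int)) = f x [^] i"
proof -
  have "f x \<in> H" using assms by (auto simp: endo_on_iff)
  then show ?thesis
    using group_hom.hom_int_pow[OF endo_on_group_hom[OF assms(1,2)], of x i] assms
    by (simp add: int_pow_consistent[OF assms(1)])
qed

lemma endo_on_int_pow_fun:
  assumes "subgroup H G" "\<And>x y. x \<in> H \<Longrightarrow> y \<in> H \<Longrightarrow> x \<otimes> y = y \<otimes> x"
  shows "endo_on H (\<lambda>x. x [^] (i::int))"
  using assms subgroup.mem_carrier[OF assms(1)]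
  by (auto simp: endo_on_iff subgroup_int_pow_closed int_pow_mult_distrib)

lemma endo_on_trivial: "subgroup H G \<Longrightarrow> endo_on H (\<lambda>_. \<one>)"
  by (auto simp: endo_on_iff subgroup.one_closed)

lemma cyclic_subgroup_iff:
  "cyclic_subgroup H G \<longleftrightarrow> subgroup H G \<and> (\<exists>x\<in>H. H = range (\<lambda>n::int. x [^] n))"
proof -
  have "cyclic_group (G\<lparr>carrier := H\<rparr>) \<longleftrightarrow> (\<exists>x\<in>H. H = range (\<lambda>n::int. x [^] n))" if H: "subgroup H G"
  proof -
    interpret H: group "G\<lparr>carrier := H\<rparr>" using H by (rule subgroup.subgroup_is_group) (rule is_group)
    have "(\<lambda>n::int. x [^]\<^bsub>G\<lparr>carrier := H\<rparr>\<^esub> n) = (\<lambda>n::int. x [^] n)" if "x \<in> H" for x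
      using int_pow_consistent[OF H that] by auto
    then show ?thesis using H.cyclic_group by auto
  qed
  then show ?thesis by (auto simp: cyclic_subgroup_def)
qed

lemma range_int_pow_eq_generate: "x \<in> carrier G \<Longrightarrow> range (\<lambda>n::int. x [^] n) = generate G {x}"
  using generate_pow by auto

lemma cyclic_subgroup_generate: "x \<in> carrier G \<Longrightarrow> cyclic_subgroup (generate G {x}) G"
  using generate_is_subgroup[of "{x}"] range_int_pow_eq_generate[of x] generate.incl[of x "{x}" G]
  by (auto simp: cyclic_subgroup_iff)

lemma cyclic_subgroupE:
  assumes "cyclic_subgroup H G"
  obtains z where "z \<in> H" "z \<in> carrier G" "subgroup H G" "ord z = card H"
    "\<forall>x\<in>H. \<exists>i::int. x = z [^] i"
proof -
  obtain z where z: "subgroup H G" "z \<in> H" "H = range (\<lambda>n::int. z [^] n)"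
    using assms by (auto simp: cyclic_subgroup_iff)
  moreover have "z \<in> carrier G" using z subgroup.mem_carrier by metis
  moreover have "H = generate G {z}" using z(3) range_int_pow_eq_generate calculation by blast
  moreover have "ord z = card H" using generate_pow_card calculation by metis
  ultimately show ?thesis using that by blast
qed

lemma cyclic_subgroup_commute:
  assumes "cyclic_subgroup H G" "x \<in> H" "y \<in> H"
  shows "x \<otimes> y = y \<otimes> x"
proof -
  obtain z where z: "z \<in> carrier G" "\<forall>x\<in>H. \<exists>i::int. x = z [^] i"
    using assms(1) by (elim cyclic_subgroupE) blast
  then obtain i j :: int where "x = z [^] i" "y = z [^] j" using assms by metis
  then show ?thesis using z by (simp add: int_pow_mult[symmetric] add.commute)
qed

lemma int_pow_eq_iff: "x \<in> carrier G \<Longrightarrow> x [^] (i::int) = x [^] j \<longleftrightarrow> i mod int (ord x) = j mod int (ord x)"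
  by (auto simp: int_pow_eq mod_eq_dvd_iff dvd_diff_commute)

text \<open>Lagrange inside H: the order of x divides the order of H.\<close>

lemma int_pow_mod_card:
  assumes "subgroup H G" "x \<in> H" "finite (carrier G)"
  shows "x [^] (i mod int (card H)) = x [^] i"
proof -
  have x: "x \<in> carrier G" using assms subgroup.mem_carrier by metis
  have "generate G {x} \<subseteq> H" using assms by (intro generate_subgroup_incl) auto
  moreover have "group (G\<lparr>carrier := H\<rparr>)" using assms(1) by (rule subgroup.subgroup_is_group) (rule is_group)
  moreover have "subgroup (generate G {x}) G" using x generate_is_subgroup by simp
  ultimately have "card (rcosets\<^bsub>G\<lparr>carrier := H\<rparr>\<^esub> generate G {x}) * card (generate G {x}) = card H"
    using group.lagrange[of "G\<lparr>carrier := H\<rparr>" "generate G {x}"] subgroup_incl[of "generate G {x}" H] assms(1)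
    by (simp add: order_def)
  then have "card (generate G {x}) dvd card H" by (metis dvd_triv_right)
  then have "int (ord x) dvd int (card H)" using generate_pow_card[OF x] by simp
  then show ?thesis using x by (simp add: int_pow_eq_iff mod_mod_cancel)
qed

text \<open>The residue modulo \<open>card M\<close> by which f multiplies on M, in its canonical
  representative. It is meaningful only if f acts on M as a power map.\<close>

definition expo :: "'a set \<Rightarrow> ('a \<Rightarrow> 'a) \<Rightarrow> int" where
  "expo M f = (SOME i. 0 \<le> i \<and> i < int (card M) \<and> (\<forall>x\<in>M. f x = x [^] i))"

lemma expo_cong: "(\<And>x. x \<in> M \<Longrightarrow> f x = g x) \<Longrightarrow> expo M f = expo M g"
  by (simp add: expo_def cong: conj_cong ball_cong)

end

section \<open>Finite groups: endomorphisms of cyclic subgroups as power maps\<close>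

locale finite_group = group +
  assumes fin: "finite (carrier G)"
begin

lemma subgroup_finite: "subgroup H G \<Longrightarrow> finite H"
  using fin finite_subset subgroup.subset by blast

lemma subgroup_card_pos: "subgroup H G \<Longrightarrow> card H > 0"
  using subgroup_finite subgroup.one_closed card_gt_0_iff by blast

text \<open>A generator of M has order \<open>card M\<close>, so its image under a power map fixes
  the exponent modulo \<open>card M\<close>.\<close>

lemma expo_eqI:
  assumes M: "cyclic_subgroup M G" and i: "\<And>x. x \<in> M \<Longrightarrow> f x = x [^] (i::int)"
  shows "expo M f = i mod int (card M)"
proof -
  obtain z where z: "z \<in> M" "z \<in> carrier G" "subgroup M G" "ord z = card M"
    using M by (rule cyclic_subgroupE)
  show ?thesis
    unfolding expo_def
  proof (rule some_equality)
    show "0 \<le> i mod int (card M) \<and> i mod int (card M) < int (card M) \<and> (\<forall>x\<in>M. f x = x [^] (i mod int (card M)))"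
      using subgroup_card_pos[OF z(3)] int_pow_mod_card[OF z(3) _ fin] i by simp
    fix j assume j: "0 \<le> j \<and> j < int (card M) \<and> (\<forall>x\<in>M. f x = x [^] j)"
    then have "z [^] i = z [^] j" using i z by simp
    then show "j = i mod int (card M)" using z j by (simp add: int_pow_eq_iff)
  qed
qed

text \<open>An endomorphism sends a generator z of M to some power of z, and then raises every power
  of z to the same exponent.\<close>

lemma
  assumes M: "cyclic_subgroup M G" and f: "endo_on M f"
  shows expo: "x \<in> M \<Longrightarrow> f x = x [^] expo M f" and expo_bounds: "0 \<le> expo M f" "expo M f < int (card M)"
proof -
  obtain z where z: "z \<in> M" "z \<in> carrier G" "subgroup M G" "ord z = card M"
      "\<forall>x\<in>M. \<exists>i::int. x = z [^] i"
    using M by (rule cyclic_subgroupE)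
  have "f z \<in> M" using f z by (simp add: endo_on_iff)
  then obtain i :: int where i: "f z = z [^] i" using z by blast
  have *: "f x = x [^] i" if x: "x \<in> M" for x
  proof -
    obtain j :: int where "x = z [^] j" using z x by blast
    then show ?thesis using endo_on_int_pow[OF z(3) f z(1)] i z(2) by (simp add: int_pow_pow mult.commute)
  qed
  then have e: "expo M f = i mod int (card M)" by (rule expo_eqI[OF M])
  show "0 \<le> expo M f" "expo M f < int (card M)" using e subgroup_card_pos[OF z(3)] by simp_all
  show "x \<in> M \<Longrightarrow> f x = x [^] expo M f" using e * int_pow_mod_card[OF z(3) _ fin] by simp
qed

lemma ord_dvd_card: "subgroup H G \<Longrightarrow> x \<in> H \<Longrightarrow> ord x dvd card H"
proof -
  assume H: "subgroup H G" "x \<in> H"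
  then have x: "x \<in> carrier G" using subgroup.mem_carrier by metis
  have "x [^] (int (card H)) = \<one>" using int_pow_mod_card[OF H fin, of "int (card H)"] by simp
  then show ?thesis using x by (simp add: int_pow_int pow_eq_id)
qed

lemma generate_subset: "subgroup H G \<Longrightarrow> x \<in> H \<Longrightarrow> generate G {x} \<subseteq> H"
  by (intro generate_subgroup_incl) auto

end

section \<open>Subgroups of order p in a p-group\<close>

locale p_group = finite_group +
  fixes p e :: nat
  assumes prime: "prime p" and order: "order G = p ^ e"
begin

lemma p_pos: "p > 0" "p > 1" "int p > 1" "p \<noteq> 0"
  using prime prime_gt_1_nat[OF prime] by auto

lemma order_p_generate:
  assumes K: "subgroup K G" "card K = p" and x: "x \<in> K" "x \<noteq> \<one>"
  shows "K = generate G {x}" "ord x = p"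
proof -
  have xc: "x \<in> carrier G" using K x subgroup.mem_carrier by metis
  have "ord x dvd p" using ord_dvd_card[OF K(1) x(1)] K by simp
  then show o: "ord x = p" using prime x xc by (metis ord_eq_1 prime_nat_iff)
  show "K = generate G {x}"
    using card_subset_eq[OF subgroup_finite[OF K(1)] generate_subset[OF K(1) x(1)]] generate_pow_card[OF xc] o K
    by simp
qed

lemma order_p_cyclic: "subgroup K G \<Longrightarrow> card K = p \<Longrightarrow> cyclic_subgroup K G"
proof -
  assume K: "subgroup K G" "card K = p"
  have "K \<noteq> {\<one>}" using K p_pos by auto
  then obtain x where x: "x \<in> K" "x \<noteq> \<one>" using K subgroup.one_closed by blast
  then show ?thesis using order_p_generate[OF K x] cyclic_subgroup_generate K subgroup.mem_carrier by metis
qed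

lemma generate_order_p:
  assumes "x \<in> carrier G" "x [^] p = \<one>" "x \<noteq> \<one>"
  shows "subgroup (generate G {x}) G" "card (generate G {x}) = p" "x \<in> generate G {x}"
proof -
  have "ord x dvd p" using assms by (simp add: pow_eq_id)
  then have "ord x = p" using prime assms by (metis ord_eq_1 prime_nat_iff)
  then show "card (generate G {x}) = p" using generate_pow_card assms by simp
  show "subgroup (generate G {x}) G" using generate_is_subgroup assms by simp
  show "x \<in> generate G {x}" by (simp add: generate.incl)
qed

lemma ex_order_p_subgroup:
  assumes H: "subgroup H G" and x: "x \<in> H" "x \<noteq> \<one>"
  shows "\<exists>K. subgroup K G \<and> card K = p \<and> K \<subseteq> H"
proof -
  have xc: "x \<in> carrier G" using H x subgroup.mem_carrier by metis
  have "ord x dvd p ^ e" using ord_dvd_group_order[OF xc] order by simp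
  then obtain n where n: "ord x = p ^ n" using divides_primepow_nat[OF prime] by blast
  have "n \<noteq> 0" using n x xc ord_eq_1[OF xc] by auto
  then obtain m where m: "n = Suc m" using not0_implies_Suc by blast
  \<comment> \<open>As x has order p^(m+1), this power of x has order exactly p.\<close>
  define y where "y = x [^] (p ^ m)"
  have "ord y = p" unfolding y_def using ord_pow[OF xc, of "p ^ m"] n m p_pos by simp
  moreover have "y \<in> H" using subgroup_int_pow_closed[OF H x(1), of "int (p ^ m)"] unfolding y_def int_pow_int .
  moreover have "y \<in> carrier G" using xc by (simp add: y_def)
  ultimately show ?thesis
    using generate_is_subgroup[of "{y}"] generate_pow_card[of y] generate_subset[OF H] by (intro exI[of _ "generate G {y}"]) auto
qed

text \<open>Let z generate M and let |M| = pq. If z^i lies in a subgroup of order p, then pq divides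
  ip, so q divides i. Hence each such subgroup lies in the group generated by z^q, which itself has
  only p elements.\<close>

lemma cyclic_order_p_unique:
  assumes M: "cyclic_subgroup M G"
    and K: "subgroup K G" "card K = p" "K \<subseteq> M"
    and L: "subgroup L G" "card L = p" "L \<subseteq> M"
  shows "K = L"
proof -
  obtain z where z: "z \<in> M" "z \<in> carrier G" "subgroup M G" "ord z = card M"
      "\<forall>x\<in>M. \<exists>i::int. x = z [^] i"
    using M by (rule cyclic_subgroupE)
  have nt: "\<exists>x\<in>K. x \<noteq> \<one>" if "subgroup K G" "card K = p" for K
  proof (rule ccontr)
    assume "\<not> ?thesis"
    then have "K = {\<one>}" using that subgroup.one_closed by blast
    then show False using that p_pos by simp
  qed
  obtain x where x: "x \<in> K" "x \<noteq> \<one>" using nt K by blast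
  have "p dvd card M" using ord_dvd_card[OF z(3), of x] order_p_generate[OF K(1,2) x] x K by auto
  then obtain q where q: "card M = p * q" by blast
  have qpos: "q > 0" using subgroup_card_pos[OF z(3)] q by simp
  have *: "y \<in> generate G {z [^] q}" if "subgroup K G" "card K = p" "K \<subseteq> M" "y \<in> K" for K y
  proof -
    have "y \<in> M" using that by auto
    then obtain i :: int where i: "y = z [^] i" using z(5) by blast
    have "ord y dvd p" using ord_dvd_card[OF that(1,4)] that by simp
    moreover have "y \<in> carrier G" using i z by simp
    ultimately have "y [^] int p = \<one>" by (simp add: int_pow_int pow_eq_id)
    then have "z [^] (i * int p) = z [^] (0::int)" using i z by (simp add: int_pow_pow)
    then have "int (ord z) dvd i * int p" unfolding int_pow_eq_iff[OF z(2)] by (simp add: mod_eq_0_iff_dvd)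
    then have "int p * int q dvd i * int p" using z q by simp
    then have "int q dvd i" using p_pos by (simp add: mult.commute[of i])
    then obtain k where "i = int q * k" by blast
    then have "y = (z [^] q) [^] k" using i z by (simp add: int_pow_pow int_pow_int[symmetric])
    moreover have "z [^] q \<in> carrier G" using z by simp
    ultimately show ?thesis using generate_pow[of "z [^] q"] by auto
  qed
  have zq: "z [^] q \<in> carrier G" using z by simp
  have "ord (z [^] q) = p" using ord_pow[OF z(2), of q] z(4) q qpos by simp
  then have c: "card (generate G {z [^] q}) = p" using generate_pow_card[OF zq] by simp
  have f: "finite (generate G {z [^] q})" using generate_is_subgroup[of "{z [^] q}"] zq subgroup_finite by simp
  have "N = generate G {z [^] q}" if "subgroup N G" "card N = p" "N \<subseteq> M" for N
    using *[OF that] that c f by (intro card_subset_eq) auto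
  then show ?thesis using K L by blast
qed

section \<open>Elementary abelian subgroups of order p^2 as planes over Z_p\<close>

definition elab :: "'a set \<Rightarrow> bool" where
  "elab E \<longleftrightarrow> elementary_abelian_subgroup p E G \<and> card E = p\<^sup>2"

lemma elabD:
  assumes "elab E"
  shows "subgroup E G" "\<And>x y. x \<in> E \<Longrightarrow> y \<in> E \<Longrightarrow> x \<otimes> y = y \<otimes> x" "\<And>x. x \<in> E \<Longrightarrow> x [^] p = \<one>"
    "card E = p\<^sup>2" "\<And>x. x \<in> E \<Longrightarrow> x \<in> carrier G"
  using assms comm_groupE(4)[of "G\<lparr>carrier := E\<rparr>"] subgroup.mem_carrier
  by (fastforce simp: elab_def elementary_abelian_subgroup_def)+

lemma elab_pow_mod: "elab E \<Longrightarrow> x \<in> E \<Longrightarrow> x [^] (i mod int p) = x [^] (i::int)"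
proof -
  assume E: "elab E" "x \<in> E"
  note eE = elabD[OF E(1)]
  have "ord x dvd p" using eE(3,5)[OF E(2)] by (simp add: pow_eq_id)
  then show ?thesis using eE(5)[OF E(2)] by (simp add: int_pow_eq_iff mod_mod_cancel)
qed

text \<open>E is a plane over Z_p and \<open>generate G {a}\<close> is the line through a, so being
  off this line is linear independence.\<close>

definition basis :: "'a set \<Rightarrow> 'a \<Rightarrow> 'a \<Rightarrow> bool" where
  "basis E a b \<longleftrightarrow> elab E \<and> a \<in> E \<and> b \<in> E \<and> a \<noteq> \<one> \<and> b \<notin> generate G {a}"

definition comb :: "'a \<Rightarrow> 'a \<Rightarrow> int \<Rightarrow> int \<Rightarrow> 'a" where
  "comb a b i j = a [^] i \<otimes> b [^] j"

lemma comb_closed: "elab E \<Longrightarrow> a \<in> E \<Longrightarrow> b \<in> E \<Longrightarrow> comb a b i j \<in> E"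
  by (simp add: comb_def elabD(1) subgroup.m_closed subgroup_int_pow_closed)

lemma comb_mult:
  assumes "elab E" "a \<in> E" "b \<in> E"
  shows "comb a b i j \<otimes> comb a b k l = comb a b (i + k) (j + l)"
proof -
  note eE = elabD[OF assms(1)]
  have [simp]: "a \<in> carrier G" "b \<in> carrier G" using eE assms by auto
  have "b [^] j \<otimes> a [^] k = a [^] k \<otimes> b [^] j"
    using eE assms by (simp add: subgroup_int_pow_closed)
  then have "a [^] i \<otimes> (b [^] j \<otimes> a [^] k) \<otimes> b [^] l = a [^] i \<otimes> (a [^] k \<otimes> b [^] j) \<otimes> b [^] l" by simp
  then show ?thesis by (simp add: comb_def int_pow_mult m_assoc)
qed

lemma comb_pow:
  assumes "elab E" "a \<in> E" "b \<in> E"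
  shows "comb a b i j [^] (k::int) = comb a b (i * k) (j * k)"
proof -
  note eE = elabD[OF assms(1)]
  have [simp]: "a \<in> carrier G" "b \<in> carrier G" using eE assms by auto
  have "a [^] i \<otimes> b [^] j = b [^] j \<otimes> a [^] i" using eE assms by (simp add: subgroup_int_pow_closed)
  then show ?thesis using int_pow_mult_distrib[of "a [^] i" "b [^] j" k] by (simp add: comb_def int_pow_pow)
qed

lemma comb_mod: "elab E \<Longrightarrow> a \<in> E \<Longrightarrow> b \<in> E \<Longrightarrow> comb a b (i mod int p) (j mod int p) = comb a b i j"
  by (simp add: comb_def elab_pow_mod)

lemma basis_ord:
  assumes "basis E a b" shows "ord a = p" "ord b = p"
proof -
  have E: "elab E" "a \<in> E" "b \<in> E" "a \<noteq> \<one>" "b \<noteq> \<one>" using assms generate.one by (auto simp: basis_def)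
  note eE = elabD[OF E(1)]
  have "ord x = p" if "x \<in> E" "x \<noteq> \<one>" for x
  proof -
    have "ord x dvd p" using eE(3,5)[OF that(1)] by (simp add: pow_eq_id)
    then show ?thesis using prime eE(5) that by (metis ord_eq_1 prime_nat_iff)
  qed
  then show "ord a = p" "ord b = p" using E by auto
qed

lemma comb_eq_iff:
  assumes "basis E a b"
  shows "comb a b i j = comb a b k l \<longleftrightarrow> i mod int p = k mod int p \<and> j mod int p = l mod int p"
proof
  have E: "elab E" "a \<in> E" "b \<in> E" "a \<noteq> \<one>" "b \<notin> generate G {a}" using assms by (auto simp: basis_def)
  note eE = elabD[OF E(1)] and o = basis_ord[OF assms]
  have [simp]: "a \<in> carrier G" "b \<in> carrier G" using eE E by auto
  show "comb a b i j = comb a b k l" if "i mod int p = k mod int p \<and> j mod int p = l mod int p"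
    using that comb_mod[OF E(1-3)] by metis
  assume eq: "comb a b i j = comb a b k l"
  \<comment> \<open>Both sides of \<open>eq\<close> contain the factor \<open>comb a b k j\<close>.
    Cancelling it leaves a power of a on one side and a power of b on the other.\<close>
  have "comb a b (i - k) 0 \<otimes> comb a b k j = comb a b 0 (l - j) \<otimes> comb a b k j"
    using eq by (simp add: comb_mult[OF E(1-3)])
  then have ab: "a [^] (i - k) = b [^] (l - j)"
    by (simp add: comb_def)
  \<comment> \<open>Otherwise l - j is invertible modulo p, and b would be a power of a.\<close>
  have "int p dvd l - j"
  proof (rule ccontr)
    assume "\<not> int p dvd l - j"
    then have "coprime (l - j) (int p)" using prime by (metis coprime_commute prime_imp_coprime prime_nat_int_transfer)
    then obtain t where "[(l - j) * t = 1] (mod int p)" using cong_solve_coprime_int by blast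
    then have "b [^] ((l - j) * t) = b [^] (1::int)" using o int_pow_eq_iff[of b "(l - j) * t" 1] by (simp add: cong_def)
    then have "b = a [^] ((i - k) * t)" using ab by (metis int_pow_1 int_pow_pow \<open>a \<in> carrier G\<close> \<open>b \<in> carrier G\<close>)
    then show False using E(5) generate_pow[of a] by auto
  qed
  then have jl: "j mod int p = l mod int p" by (metis mod_eq_dvd_iff)
  then have "b [^] j = b [^] l" using o by (simp add: int_pow_eq_iff)
  then have "a [^] i = a [^] k" using eq by (simp add: comb_def)
  then show "i mod int p = k mod int p \<and> j mod int p = l mod int p"
    using jl o by (simp add: int_pow_eq_iff)
qed

text \<open>Counting replaces a spanning argument: by \<open>comb_eq_iff\<close> there are p^2
  distinct combinations with reduced coefficients, and E has p^2 elements.\<close>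

lemma comb_surj:
  assumes B: "basis E a b" and y: "y \<in> E"
  shows "\<exists>i\<in>{0..<int p}. \<exists>j\<in>{0..<int p}. y = comb a b i j"
proof -
  have E: "elab E" "a \<in> E" "b \<in> E" using B by (auto simp: basis_def)
  let ?S = "{0..<int p} \<times> {0..<int p}"
  have "inj_on (\<lambda>(i, j). comb a b i j) ?S"
    by (auto simp: inj_on_def comb_eq_iff[OF B])
  then have "card ((\<lambda>(i, j). comb a b i j) ` ?S) = p\<^sup>2"
    by (simp add: card_image power2_eq_square)
  moreover have "(\<lambda>(i, j). comb a b i j) ` ?S \<subseteq> E" using comb_closed[OF E] by auto
  ultimately have "(\<lambda>(i, j). comb a b i j) ` ?S = E"
    using elabD[OF E(1)] subgroup_finite by (intro card_subset_eq) auto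
  then show ?thesis using y by auto
qed

definition crd1 :: "'a \<Rightarrow> 'a \<Rightarrow> 'a \<Rightarrow> int" where
  "crd1 a b y = (SOME i. 0 \<le> i \<and> i < int p \<and> (\<exists>j. y = comb a b i j))"

definition crd2 :: "'a \<Rightarrow> 'a \<Rightarrow> 'a \<Rightarrow> int" where
  "crd2 a b y = (SOME j. 0 \<le> j \<and> j < int p \<and> (\<exists>i. y = comb a b i j))"

lemma crd_comb:
  assumes B: "basis E a b"
  shows "crd1 a b (comb a b i j) = i mod int p" "crd2 a b (comb a b i j) = j mod int p"
proof -
  have E: "elab E" "a \<in> E" "b \<in> E" using B by (auto simp: basis_def)
  show "crd1 a b (comb a b i j) = i mod int p"
    unfolding crd1_def
    by (rule some_equality) (use p_pos comb_eq_iff[OF B] in auto)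
  show "crd2 a b (comb a b i j) = j mod int p"
    unfolding crd2_def
    by (rule some_equality) (use p_pos comb_eq_iff[OF B] in auto)
qed

lemma crd:
  assumes B: "basis E a b" and y: "y \<in> E"
  shows "y = comb a b (crd1 a b y) (crd2 a b y)"
    "0 \<le> crd1 a b y" "crd1 a b y < int p" "0 \<le> crd2 a b y" "crd2 a b y < int p"
  using comb_surj[OF B y] by (auto simp: crd_comb[OF B])

lemma endo_on_comb:
  assumes "elab E" "a \<in> E" "b \<in> E" "endo_on E f"
  shows "f (comb a b i j) = comb (f a) (f b) i j"
proof -
  note s = elabD(1)[OF assms(1)]
  have "f (comb a b i j) = f (a [^] i) \<otimes> f (b [^] j)"
    using assms s by (simp add: comb_def endo_on_iff subgroup_int_pow_closed)
  then show ?thesis using endo_on_int_pow[OF s assms(4)] assms by (simp add: comb_def)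
qed

text \<open>The linear extension of a -> u, b -> v. Coordinates are only additive modulo p, which is
  harmless because u and v are killed by p.\<close>

lemma ex_endo_on:
  assumes B: "basis E a b" and u: "u \<in> E" "v \<in> E"
  shows "\<exists>f. endo_on E f \<and> f a = u \<and> f b = v"
proof -
  have E: "elab E" "a \<in> E" "b \<in> E" using B by (auto simp: basis_def)
  note eE = elabD[OF E(1)]
  define f where "f y = comb u v (crd1 a b y) (crd2 a b y)" for y
  have f: "f (comb a b i j) = comb u v i j" for i j
    by (simp add: f_def crd_comb[OF B] comb_mod[OF E(1) u])
  have "endo_on E f"
    unfolding endo_on_iff
  proof (intro conjI ballI)
    fix x y assume xy: "x \<in> E" "y \<in> E"
    then obtain i j k l where "x = comb a b i j" "y = comb a b k l" using crd(1)[OF B] by metis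
    then show "f (x \<otimes> y) = f x \<otimes> f y"
      by (simp add: comb_mult[OF E] f comb_mult[OF E(1) u])
  qed (simp add: f_def comb_closed[OF E(1) u])
  moreover have "a = comb a b 1 0" "b = comb a b 0 1" using eE E by (simp_all add: comb_def)
  moreover have "u = comb u v 1 0" "v = comb u v 0 1" using eE u by (simp_all add: comb_def)
  ultimately show ?thesis using f by metis
qed

lemma elab_not_cyclic:
  assumes "elab E" shows "\<not> cyclic_subgroup E G"
proof
  assume "cyclic_subgroup E G"
  then obtain z where z: "z \<in> E" "ord z = card E" by (elim cyclic_subgroupE)
  note eE = elabD[OF assms]
  have "ord z dvd p" using eE(3,5)[OF z(1)] by (simp add: pow_eq_id)
  then have "p\<^sup>2 dvd p" using z eE by simp
  then show False using p_pos by (auto simp: power2_eq_square dest: dvd_imp_le)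
qed

lemma elab_ex_basis:
  assumes E: "elab E" and a: "a \<in> E" "a \<noteq> \<one>"
  shows "\<exists>b. basis E a b"
proof (rule ccontr)
  assume "\<not> ?thesis"
  then have "E \<subseteq> generate G {a}" using assms by (auto simp: basis_def)
  then have "E = generate G {a}" using generate_subset[OF elabD(1)[OF E] a(1)] by auto
  then show False using elab_not_cyclic[OF E] cyclic_subgroup_generate elabD(5)[OF E a(1)] by metis
qed

text \<open>Two distinct planes that share a line share nothing more: a common element off the line
  would complete a to a basis of both, and they would coincide.\<close>

lemma elab_inter_card:
  assumes "elab E" "elab E'" "E \<noteq> E'" "subgroup K G" "card K = p" "K \<subseteq> E \<inter> E'"
  shows "E \<inter> E' = K"
proof -
  note eE = elabD[OF assms(1)] and eE' = elabD[OF assms(2)]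
  have "K \<noteq> {\<one>}" using assms p_pos by auto
  then obtain a where a: "a \<in> K" "a \<noteq> \<one>" using assms(4) subgroup.one_closed by blast
  have K: "K = generate G {a}" using order_p_generate assms a by blast
  have "x \<in> K" if x: "x \<in> E" "x \<in> E'" for x
  proof (rule ccontr)
    assume "x \<notin> K"
    then have B: "basis E a x" "basis E' a x" using x a assms K by (auto simp: basis_def)
    have "E \<subseteq> E'" using comb_surj[OF B(1)] comb_closed[OF assms(2)] B(2) by (fastforce simp: basis_def)
    moreover have "E' \<subseteq> E" using comb_surj[OF B(2)] comb_closed[OF assms(1)] B(1) by (fastforce simp: basis_def)
    ultimately show False using assms by auto
  qed
  then show ?thesis using assms by auto
qed

end

section \<open>Star coverings and their points\<close>

locale star_cover = p_group +
  fixes \<C> :: "'a set set"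
  assumes star: "star_covering p G \<C>"
begin

definition cyc :: "'a set set" where
  "cyc = {M \<in> \<C>. maximal_cyclic_subgroup M G}"

definition ele :: "'a set set" where
  "ele = {E \<in> \<C>. elab E}"

text \<open>A cyclic member contributes its subgroup of order p even if it meets no other member in
  it. In this way every nontrivial cyclic member is attached to some point.\<close>

definition points :: "'a set set" where
  "points = {K. subgroup K G \<and> card K = p \<and>
     ((\<exists>M\<in>cyc. K \<subseteq> M) \<or> (\<exists>E\<in>ele. \<exists>E'\<in>ele. E \<noteq> E' \<and> K \<subseteq> E \<inter> E'))}"

definition pts :: "'a set \<Rightarrow> 'a set set" where
  "pts E = {K \<in> points. K \<subseteq> E}"

text \<open>Only planes with at least three points link them: two eigenlines of an endomorphism of a
  plane may have different eigenvalues, three may not.\<close>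

definition linked :: "('a set \<times> 'a set) set" where
  "linked = {(K, K'). \<exists>E\<in>ele. K \<in> pts E \<and> K' \<in> pts E \<and> 3 \<le> card (pts E)}"

abbreviation R :: "('a \<Rightarrow> 'a) ring" where
  "R \<equiv> cover_ring G \<C>"

abbreviation MC :: "'a set \<Rightarrow> 'a set set" where
  "MC \<equiv> maximal_cyclics_over G"

definition gen :: "'a set \<Rightarrow> 'a" where
  "gen K = (SOME x. x \<in> K \<and> x \<noteq> \<one>)"

lemma cover_cases: "C \<in> \<C> \<Longrightarrow> C \<in> cyc \<or> C \<in> ele"
  using star by (auto simp: star_covering_def cyc_def ele_def elab_def)

lemma cover_subgroup: "C \<in> \<C> \<Longrightarrow> subgroup C G"
  using star by (auto simp: star_covering_def group_cover_def)

lemma cover_ex: "x \<in> carrier G \<Longrightarrow> \<exists>C\<in>\<C>. x \<in> C"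
  using star by (auto simp: star_covering_def group_cover_def)

lemma cover_mem_carrier: "C \<in> \<C> \<Longrightarrow> x \<in> C \<Longrightarrow> x \<in> carrier G"
  using cover_subgroup subgroup.mem_carrier by metis

lemma cycD: "M \<in> cyc \<Longrightarrow> M \<in> \<C>" "M \<in> cyc \<Longrightarrow> cyclic_subgroup M G"
  by (auto simp: cyc_def maximal_cyclic_subgroup_def)

lemma eleD: "E \<in> ele \<Longrightarrow> E \<in> \<C>" "E \<in> ele \<Longrightarrow> elab E"
  by (auto simp: ele_def)

lemma ele_not_cyc: "E \<in> ele \<Longrightarrow> E \<notin> cyc"
  using elab_not_cyclic eleD cycD by metis

lemma cover_commute: "C \<in> \<C> \<Longrightarrow> x \<in> C \<Longrightarrow> y \<in> C \<Longrightarrow> x \<otimes> y = y \<otimes> x"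
  using cover_cases cyclic_subgroup_commute cycD eleD elabD(2) by metis

section \<open>The cover ring\<close>

lemma carrier_R: "carrier R = {f \<in> carrier G \<rightarrow>\<^sub>E carrier G. \<forall>C\<in>\<C>. endo_on C f}"
  by (auto simp: cover_ring_def endo_on_def)

lemma
  shows mult_R: "f \<otimes>\<^bsub>R\<^esub> g = compose (carrier G) f g"
    and one_R: "\<one>\<^bsub>R\<^esub> = (\<lambda>x\<in>carrier G. x)"
    and zero_R: "\<zero>\<^bsub>R\<^esub> = (\<lambda>x\<in>carrier G. \<one>)"
    and add_R: "f \<oplus>\<^bsub>R\<^esub> g = (\<lambda>x\<in>carrier G. f x \<otimes> g x)"
  by (simp_all add: cover_ring_def)

lemma R_apply:
  "x \<in> carrier G \<Longrightarrow> (f \<otimes>\<^bsub>R\<^esub> g) x = f (g x)"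
  "x \<in> carrier G \<Longrightarrow> (f \<oplus>\<^bsub>R\<^esub> g) x = f x \<otimes> g x"
  "x \<in> carrier G \<Longrightarrow> \<one>\<^bsub>R\<^esub> x = x"
  "x \<in> carrier G \<Longrightarrow> \<zero>\<^bsub>R\<^esub> x = \<one>"
  by (simp_all add: mult_R add_R one_R zero_R compose_def)

lemma
  assumes "f \<in> carrier R"
  shows R_closed: "x \<in> carrier G \<Longrightarrow> f x \<in> carrier G"
    and R_endo: "C \<in> \<C> \<Longrightarrow> endo_on C f"
    and R_cover_closed: "C \<in> \<C> \<Longrightarrow> x \<in> C \<Longrightarrow> f x \<in> C"
    and R_hom: "C \<in> \<C> \<Longrightarrow> x \<in> C \<Longrightarrow> y \<in> C \<Longrightarrow> f (x \<otimes> y) = f x \<otimes> f y"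
  using assms by (auto simp: carrier_R endo_on_iff)

lemma R_memI:
  assumes "f \<in> extensional (carrier G)" "\<And>C x. C \<in> \<C> \<Longrightarrow> x \<in> C \<Longrightarrow> f x \<in> C"
    "\<And>C x y. C \<in> \<C> \<Longrightarrow> x \<in> C \<Longrightarrow> y \<in> C \<Longrightarrow> f (x \<otimes> y) = f x \<otimes> f y"
  shows "f \<in> carrier R"
  using assms cover_ex cover_mem_carrier
  by (force simp: carrier_R endo_on_iff PiE_def)

lemma R_ext:
  assumes "f \<in> carrier R" "g \<in> carrier R" "\<And>x. x \<in> carrier G \<Longrightarrow> f x = g x"
  shows "f = g"
  using assms PiE_ext[of f "carrier G" "\<lambda>_. carrier G" g] by (auto simp: carrier_R)

lemma R_mult_closed:
  assumes f: "f \<in> carrier R" and g: "g \<in> carrier R" shows "f \<otimes>\<^bsub>R\<^esub> g \<in> carrier R"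
proof (rule R_memI)
  show "f \<otimes>\<^bsub>R\<^esub> g \<in> extensional (carrier G)" by (simp add: mult_R compose_def)
qed (use f g subgroup.m_closed[OF cover_subgroup] in
    \<open>simp_all add: R_apply cover_mem_carrier R_cover_closed R_hom\<close>)

text \<open>G itself need not be commutative. The interchange works because all four elements lie in
  one abelian member.\<close>

lemma cover_middle_swap:
  assumes "C \<in> \<C>" "a \<in> C" "b \<in> C" "c \<in> C" "d \<in> C"
  shows "(a \<otimes> b) \<otimes> (c \<otimes> d) = (a \<otimes> c) \<otimes> (b \<otimes> d)"
proof -
  have c: "a \<in> carrier G" "b \<in> carrier G" "c \<in> carrier G" "d \<in> carrier G"
    using assms cover_mem_carrier by auto
  have "a \<otimes> (b \<otimes> c) \<otimes> d = a \<otimes> (c \<otimes> b) \<otimes> d" using assms cover_commute[of C b c] by simp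
  then show ?thesis using c by (simp add: m_assoc)
qed

lemma R_add_closed:
  assumes f: "f \<in> carrier R" and g: "g \<in> carrier R" shows "f \<oplus>\<^bsub>R\<^esub> g \<in> carrier R"
proof (rule R_memI)
  show "f \<oplus>\<^bsub>R\<^esub> g \<in> extensional (carrier G)" by (simp add: add_R)
  fix C x y assume C: "C \<in> \<C>" and x: "x \<in> C" and y: "y \<in> C"
  show "(f \<oplus>\<^bsub>R\<^esub> g) (x \<otimes> y) = (f \<oplus>\<^bsub>R\<^esub> g) x \<otimes> (f \<oplus>\<^bsub>R\<^esub> g) y"
    using cover_middle_swap[OF C, of "f x" "f y" "g x" "g y"] R_cover_closed[OF _ C] f g x y
    by (simp add: R_apply cover_mem_carrier[OF C] R_hom[OF _ C])
qed (use f g subgroup.m_closed[OF cover_subgroup] in \<open>simp_all add: R_apply cover_mem_carrier R_cover_closed\<close>)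

lemma R_neg_closed:
  assumes f: "f \<in> carrier R" shows "(\<lambda>x\<in>carrier G. inv f x) \<in> carrier R"
proof (rule R_memI)
  fix C x y assume C: "C \<in> \<C>" and x: "x \<in> C" and y: "y \<in> C"
  have c: "f x \<in> C" "f y \<in> C" "f x \<in> carrier G" "f y \<in> carrier G" "x \<in> carrier G" "y \<in> carrier G"
    using f C x y R_cover_closed cover_mem_carrier by auto
  show "(\<lambda>x\<in>carrier G. inv f x) (x \<otimes> y) = (\<lambda>x\<in>carrier G. inv f x) x \<otimes> (\<lambda>x\<in>carrier G. inv f x) y"
    using c R_hom[OF f C x y] cover_commute[OF C c(1,2)] by (simp add: inv_mult_group)
qed (use f R_cover_closed cover_mem_carrier subgroup.m_inv_closed[OF cover_subgroup] in auto)

text \<open>All identities are checked pointwise. Commutativity of addition and left distributivity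
  use a member C containing x: f x and g x stay in C, where elements commute and h is
  additive.\<close>

lemma R_ring: "ring R"
proof (rule ringI)
  have z: "\<zero>\<^bsub>R\<^esub> \<in> carrier R"
    by (rule R_memI) (auto simp: zero_R cover_mem_carrier subgroup.one_closed[OF cover_subgroup])
  have o: "\<one>\<^bsub>R\<^esub> \<in> carrier R"
    by (rule R_memI) (auto simp: one_R cover_mem_carrier)
  show "abelian_group R"
  proof (rule abelian_groupI)
    fix f g h assume f: "f \<in> carrier R" and g: "g \<in> carrier R"
    show "f \<oplus>\<^bsub>R\<^esub> g \<in> carrier R" using f g by (rule R_add_closed)
    show "f \<oplus>\<^bsub>R\<^esub> g = g \<oplus>\<^bsub>R\<^esub> f"
    proof (rule R_ext)
      fix x assume x: "x \<in> carrier G"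
      then obtain C where "C \<in> \<C>" "x \<in> C" using cover_ex by blast
      then show "(f \<oplus>\<^bsub>R\<^esub> g) x = (g \<oplus>\<^bsub>R\<^esub> f) x"
        using cover_commute[of C "f x" "g x"] R_cover_closed f g x by (simp add: R_apply)
    qed (use f g R_add_closed in auto)
    show "f \<oplus>\<^bsub>R\<^esub> g \<oplus>\<^bsub>R\<^esub> h = f \<oplus>\<^bsub>R\<^esub> (g \<oplus>\<^bsub>R\<^esub> h)" if h: "h \<in> carrier R"
      by (rule R_ext) (use f g h R_closed R_add_closed in \<open>auto simp: R_apply m_assoc\<close>)
    show "\<zero>\<^bsub>R\<^esub> \<oplus>\<^bsub>R\<^esub> f = f"
      by (rule R_ext) (use f z R_closed R_add_closed in \<open>auto simp: R_apply\<close>)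
    show "\<exists>g\<in>carrier R. g \<oplus>\<^bsub>R\<^esub> f = \<zero>\<^bsub>R\<^esub>"
      by (rule bexI[of _ "\<lambda>x\<in>carrier G. inv f x"], rule R_ext)
        (use f z R_closed R_add_closed R_neg_closed in \<open>auto simp: R_apply\<close>)
  qed (use z in auto)
  show "Group.monoid R"
  proof (rule monoidI)
    fix f g h assume f: "f \<in> carrier R" and g: "g \<in> carrier R"
    show "f \<otimes>\<^bsub>R\<^esub> g \<in> carrier R" using f g by (rule R_mult_closed)
    show "f \<otimes>\<^bsub>R\<^esub> g \<otimes>\<^bsub>R\<^esub> h = f \<otimes>\<^bsub>R\<^esub> (g \<otimes>\<^bsub>R\<^esub> h)" if h: "h \<in> carrier R"
      by (rule R_ext) (use f g h R_closed R_mult_closed in \<open>auto simp: R_apply\<close>)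
  next
    fix f assume f: "f \<in> carrier R"
    show "\<one>\<^bsub>R\<^esub> \<otimes>\<^bsub>R\<^esub> f = f"
      by (rule R_ext) (use f o R_closed R_mult_closed in \<open>auto simp: R_apply\<close>)
    show "f \<otimes>\<^bsub>R\<^esub> \<one>\<^bsub>R\<^esub> = f"
      by (rule R_ext) (use f o R_closed R_mult_closed in \<open>auto simp: R_apply\<close>)
  qed (use o in auto)
  fix f g h assume f: "f \<in> carrier R" and g: "g \<in> carrier R" and h: "h \<in> carrier R"
  show "(f \<oplus>\<^bsub>R\<^esub> g) \<otimes>\<^bsub>R\<^esub> h = f \<otimes>\<^bsub>R\<^esub> h \<oplus>\<^bsub>R\<^esub> g \<otimes>\<^bsub>R\<^esub> h"
    by (rule R_ext) (use f g h R_closed R_mult_closed R_add_closed in \<open>auto simp: R_apply\<close>)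
  show "h \<otimes>\<^bsub>R\<^esub> (f \<oplus>\<^bsub>R\<^esub> g) = h \<otimes>\<^bsub>R\<^esub> f \<oplus>\<^bsub>R\<^esub> h \<otimes>\<^bsub>R\<^esub> g"
  proof (rule R_ext)
    fix x assume x: "x \<in> carrier G"
    then obtain C where "C \<in> \<C>" "x \<in> C" using cover_ex by blast
    then show "(h \<otimes>\<^bsub>R\<^esub> (f \<oplus>\<^bsub>R\<^esub> g)) x = (h \<otimes>\<^bsub>R\<^esub> f \<oplus>\<^bsub>R\<^esub> h \<otimes>\<^bsub>R\<^esub> g) x"
      using R_cover_closed R_hom[OF h, of C] f g x by (simp add: R_apply)
  qed (use f g h R_mult_closed R_add_closed in auto)
qed

lemma R_finite: "finite (carrier R)"
proof -
  have "finite (carrier G \<rightarrow>\<^sub>E carrier G)" using fin by (intro finite_PiE) auto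
  then show ?thesis by (rule rev_finite_subset) (auto simp: carrier_R)
qed

section \<open>Points and the maximal cyclic subgroups above them\<close>

lemma pointsD: "K \<in> points \<Longrightarrow> subgroup K G" "K \<in> points \<Longrightarrow> card K = p"
  by (auto simp: points_def)

lemma ptsD: "K \<in> pts E \<Longrightarrow> K \<in> points" "K \<in> pts E \<Longrightarrow> K \<subseteq> E"
  by (auto simp: pts_def)

lemma points_finite: "finite points"
  using fin pointsD(1) subgroup.subset by (metis Pow_iff finite_Pow_iff rev_finite_subset subsetI)

lemma pts_finite: "finite (pts E)"
  using points_finite by (simp add: pts_def)

lemma gen:
  assumes "K \<in> points"
  shows "gen K \<in> K" "gen K \<noteq> \<one>" "K = generate G {gen K}" "gen K \<in> carrier G"
proof -
  note K = pointsD[OF assms]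
  have "K \<noteq> {\<one>}" using K p_pos by auto
  then obtain x where "x \<in> K \<and> x \<noteq> \<one>" using K(1) subgroup.one_closed by blast
  then show *: "gen K \<in> K" "gen K \<noteq> \<one>" unfolding gen_def by (metis (mono_tags, lifting) someI_ex)+
  show "K = generate G {gen K}" using order_p_generate[OF K *] by simp
  show "gen K \<in> carrier G" using * K subgroup.mem_carrier by metis
qed

lemma point_elt: "K \<in> points \<Longrightarrow> x \<in> K \<Longrightarrow> \<exists>i::int. x = gen K [^] i"
  using gen[of K] generate_pow[of "gen K"] by auto

lemma points_cyclic: "K \<in> points \<Longrightarrow> cyclic_subgroup K G"
  using pointsD order_p_cyclic by blast

lemma points_cover: "K \<in> points \<Longrightarrow> \<exists>C\<in>\<C>. K \<subseteq> C"
  by (auto simp: points_def cyc_def ele_def)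

text \<open>In a cyclic member f is a power map and preserves every subgroup. A point in no cyclic
  member is the full intersection of two elementary abelian members, both preserved by f.\<close>

lemma endo_point:
  assumes K: "K \<in> points" and f: "f \<in> carrier R"
  shows "endo_on K f"
proof -
  obtain C where C: "C \<in> \<C>" "K \<subseteq> C" using points_cover K by blast
  have "f x \<in> K" if x: "x \<in> K" for x
  proof (cases "\<exists>M\<in>cyc. K \<subseteq> M")
    case True
    then obtain M where M: "M \<in> cyc" "K \<subseteq> M" by blast
    then have "f x = x [^] expo M f" using expo cycD f R_endo x by blast
    then show ?thesis using subgroup_int_pow_closed[OF pointsD(1)[OF K] x] by simp
  next
    case False
    then obtain E E' where E: "E \<in> ele" "E' \<in> ele" "E \<noteq> E'" "K \<subseteq> E \<inter> E'" using K by (auto simp: points_def)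
    then have "E \<inter> E' = K" using elab_inter_card[OF eleD(2) eleD(2)] pointsD[OF K] by simp
    then show ?thesis using R_cover_closed[OF f] E eleD x by blast
  qed
  then show ?thesis using R_hom[OF f C(1)] C(2) by (auto simp: endo_on_iff)
qed

lemma MC_D:
  "M \<in> MC K \<Longrightarrow> cyclic_subgroup M G" "M \<in> MC K \<Longrightarrow> K \<subseteq> M" "M \<in> MC K \<Longrightarrow> subgroup M G"
  by (auto simp: maximal_cyclics_over_def maximal_cyclic_subgroup_def cyclic_subgroup_def)

text \<open>M need not belong to the cover, but its generator lies in some member C, hence so does
  M. If C is cyclic, maximality gives M = C. If C is elementary abelian, M has at most p elements
  and equals K.\<close>

lemma MC_cases:
  assumes K: "K \<in> points" and M: "M \<in> MC K"
  shows "M \<in> cyc \<or> M = K"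
proof -
  obtain z where z: "z \<in> M" "z \<in> carrier G" "subgroup M G" "ord z = card M"
    "\<forall>x\<in>M. \<exists>i::int. x = z [^] i"
    using MC_D(1)[OF M] by (rule cyclic_subgroupE)
  obtain C where C: "C \<in> \<C>" "z \<in> C" using z cover_ex by blast
  have MC: "M \<subseteq> C" using z(5) subgroup_int_pow_closed[OF cover_subgroup C(2)] C(1) by auto
  show ?thesis
  proof (cases "C \<in> cyc")
    case True
    then have "M = C" using MC M cycD by (auto simp: maximal_cyclics_over_def maximal_cyclic_subgroup_def)
    then show ?thesis using True by simp
  next
    case False
    then have "elab C" using C cover_cases eleD by blast
    then have "ord z dvd p" using elabD(3)[of C z] z C by (simp add: pow_eq_id)
    then have "card M \<le> card K" using z pointsD[OF K] p_pos by (auto dest: dvd_imp_le)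
    then have "K = M" using MC_D(2)[OF M] subgroup_finite[OF z(3)] by (intro card_seteq) auto
    then show ?thesis by simp
  qed
qed

lemma cyc_MC: "M \<in> cyc \<Longrightarrow> K \<subseteq> M \<Longrightarrow> M \<in> MC K"
  by (auto simp: maximal_cyclics_over_def cyc_def)

lemma endo_MC: "K \<in> points \<Longrightarrow> M \<in> MC K \<Longrightarrow> f \<in> carrier R \<Longrightarrow> endo_on M f"
  using MC_cases endo_point R_endo cycD by metis

lemma MC_nonempty:
  assumes K: "K \<in> points" shows "MC K \<noteq> {}"
proof -
  let ?S = "{H. cyclic_subgroup H G \<and> K \<subseteq> H}"
  have "?S \<subseteq> Pow (carrier G)" using subgroup.subset by (auto simp: cyclic_subgroup_def)
  then have "finite ?S" using fin by (metis finite_Pow_iff finite_subset)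
  moreover have "K \<in> ?S" using K points_cyclic by simp
  ultimately obtain M where "M \<in> ?S" "\<forall>H\<in>?S. M \<subseteq> H \<longrightarrow> M = H" using finite_has_maximal[of ?S] by blast
  then have "M \<in> MC K" by (auto simp: maximal_cyclics_over_def maximal_cyclic_subgroup_def)
  then show ?thesis by auto
qed

text \<open>Because of this, exponents can be prescribed on maximal cyclic subgroups separately for
  each point.\<close>

lemma MC_point_unique: "K \<in> points \<Longrightarrow> K' \<in> points \<Longrightarrow> M \<in> MC K \<Longrightarrow> M \<in> MC K' \<Longrightarrow> K = K'"
  using cyclic_order_p_unique pointsD MC_D by metis

lemma cyc_point:
  assumes M: "M \<in> cyc" and x: "x \<in> M" "x \<noteq> \<one>"
  shows "\<exists>K\<in>points. M \<in> MC K"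
proof -
  obtain K where "subgroup K G" "card K = p" "K \<subseteq> M"
    using ex_order_p_subgroup[OF cover_subgroup[OF cycD(1)[OF M]] x] by blast
  then show ?thesis using M cyc_MC by (auto simp: points_def)
qed

lemma cyc_inter_point:
  assumes M: "M \<in> cyc" "M' \<in> cyc" and x: "x \<in> M" "x \<in> M'" "x \<noteq> \<one>"
  shows "\<exists>K\<in>points. M \<in> MC K \<and> M' \<in> MC K"
proof -
  have "subgroup (M \<inter> M') G" using M cover_subgroup cycD subgroups_Inter_pair by blast
  then obtain K where "subgroup K G" "card K = p" "K \<subseteq> M \<inter> M'"
    using ex_order_p_subgroup[of "M \<inter> M'"] x by blast
  then show ?thesis using M cyc_MC by (auto simp: points_def)
qed

text \<open>Here x has order p, so the subgroup it generates is itself the point. For two cyclic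
  members x may lie outside the point, which is why \<open>cyc_inter_point\<close> does not place x
  in K.\<close>

lemma ele_inter_point:
  assumes C: "C \<in> ele" "C' \<in> \<C>" "C \<noteq> C'" and x: "x \<in> C" "x \<in> C'" "x \<noteq> \<one>"
  shows "\<exists>K\<in>points. x \<in> K \<and> K \<subseteq> C \<and> K \<subseteq> C'"
proof -
  have K: "subgroup (generate G {x}) G" "card (generate G {x}) = p" "x \<in> generate G {x}"
    using generate_order_p[of x] elabD[of C] eleD[OF C(1)] x by auto
  have s: "generate G {x} \<subseteq> C" "generate G {x} \<subseteq> C'"
    using generate_subset[OF cover_subgroup] C eleD x by auto
  have "generate G {x} \<in> points"
    using cover_cases[OF C(2)] K(1,2) s C(1,3) unfolding points_def by blast
  then show ?thesis using K s by blast
qed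

lemma pts_basis:
  assumes E: "E \<in> ele" and K: "K \<in> pts E" "K' \<in> pts E" "K \<noteq> K'"
  shows "basis E (gen K) (gen K')"
proof -
  note g = gen[OF ptsD(1)[OF K(1)]] and g' = gen[OF ptsD(1)[OF K(2)]]
  have "gen K' \<notin> K"
    using order_p_generate(1)[of K "gen K'"] pointsD[OF ptsD(1)[OF K(1)]] g' K(3) by auto
  moreover have "gen K \<in> E" "gen K' \<in> E" using g(1) g'(1) ptsD(2)[OF K(1)] ptsD(2)[OF K(2)] by auto
  ultimately show ?thesis using g g' eleD[OF E] by (simp add: basis_def)
qed

text \<open>A third point L of the plane has a generator with both coordinates i, j nonzero in the
  basis given by K and K'. Applying f and comparing coordinates gives i * expo L = i * expo K and j
  * expo L = j * expo K' modulo p, and i and j can be cancelled.\<close>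

lemma linked_expo:
  assumes KK: "(K, K') \<in> linked" and f: "f \<in> carrier R"
  shows "expo K f = expo K' f"
proof (cases "K = K'")
  case False
  obtain E where E: "E \<in> ele" "K \<in> pts E" "K' \<in> pts E" "3 \<le> card (pts E)"
    using KK by (auto simp: linked_def)
  have "\<not> pts E \<subseteq> {K, K'}"
  proof
    assume "pts E \<subseteq> {K, K'}"
    then have "card (pts E) \<le> card {K, K'}" by (intro card_mono) auto
    then show False using E(4) card_insert_le_m1[of 2 "{K'}" K] by simp
  qed
  then obtain L where L: "L \<in> pts E" "L \<noteq> K" "L \<noteq> K'" by auto
  have B: "basis E (gen K) (gen K')" using pts_basis[OF E(1-3) False] .
  then have EB: "elab E" "gen K \<in> E" "gen K' \<in> E" by (auto simp: basis_def)
  have pt: "K \<in> points" "K' \<in> points" "L \<in> points" using E L ptsD by auto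
  have LE: "gen L \<in> E" using gen(1)[OF pt(3)] L ptsD by blast
  define i where "i = crd1 (gen K) (gen K') (gen L)"
  define j where "j = crd2 (gen K) (gen K') (gen L)"
  have ij: "gen L = comb (gen K) (gen K') i j" "0 \<le> i" "i < int p" "0 \<le> j" "j < int p"
    using crd[OF B LE] by (simp_all add: i_def j_def)
  have gL: "gen L \<notin> K" "gen L \<notin> K'"
    using order_p_generate(1)[of K "gen L"] order_p_generate(1)[of K' "gen L"] pointsD pt gen(2,3)[OF pt(3)] L by auto
  \<comment> \<open>With i = 0 the generator of L would lie in K', and with j = 0 in K.\<close>
  have "i \<noteq> 0"
    using gL(2) ij(1) subgroup_int_pow_closed[OF pointsD(1)[OF pt(2)] gen(1)[OF pt(2)], of j] gen(4)[OF pt(2)]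
    by (auto simp: comb_def)
  have "j \<noteq> 0"
    using gL(1) ij(1) subgroup_int_pow_closed[OF pointsD(1)[OF pt(1)] gen(1)[OF pt(1)], of i] gen(4)[OF pt(1)]
    by (auto simp: comb_def)
  have ex: "f (gen N) = gen N [^] expo N f" if "N \<in> points" for N
    using expo[OF points_cyclic[OF that] endo_point[OF that f] gen(1)[OF that]] .
  have "f (gen L) = comb (f (gen K)) (f (gen K')) i j"
    unfolding ij(1) using endo_on_comb[OF EB R_endo[OF f eleD(1)[OF E(1)]]] .
  also have "\<dots> = comb (gen K) (gen K') (expo K f * i) (expo K' f * j)"
    using gen(4) pt by (simp add: ex comb_def int_pow_pow)
  also have "f (gen L) = comb (gen K) (gen K') (i * expo L f) (j * expo L f)"
    unfolding ex[OF pt(3)] by (subst ij(1)) (rule comb_pow[OF EB])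
  finally have c: "[i * expo L f = i * expo K f] (mod int p)" "[j * expo L f = j * expo K' f] (mod int p)"
    by (simp_all add: comb_eq_iff[OF B] cong_def mult.commute)
  have cop: "coprime k (int p)" if "0 \<le> k" "k < int p" "k \<noteq> 0" for k
  proof -
    have "\<not> int p dvd k" using that zdvd_not_zless by auto
    then show ?thesis using prime by (metis coprime_commute prime_imp_coprime prime_nat_int_transfer)
  qed
  have "[expo L f = expo K f] (mod int p)" "[expo L f = expo K' f] (mod int p)"
    using c cop[OF ij(2,3) \<open>i \<noteq> 0\<close>] cop[OF ij(4,5) \<open>j \<noteq> 0\<close>] cong_mult_lcancel by blast+
  then have "[expo K f = expo K' f] (mod int p)" by (metis cong_sym cong_trans)
  then show ?thesis
    using expo_bounds[OF points_cyclic endo_point[OF _ f]] pt pointsD(2)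
    by (intro cong_less_imp_eq_int[of _ "int p"]) auto
qed auto

section \<open>Gluing endomorphisms of the members\<close>

lemma glue:
  assumes e: "\<And>C. C \<in> \<C> \<Longrightarrow> endo_on C (\<phi> C)"
    and agree: "\<And>C C' x. C \<in> \<C> \<Longrightarrow> C' \<in> \<C> \<Longrightarrow> x \<in> C \<Longrightarrow> x \<in> C' \<Longrightarrow> \<phi> C x = \<phi> C' x"
  shows "\<exists>f\<in>carrier R. \<forall>C\<in>\<C>. \<forall>x\<in>C. f x = \<phi> C x"
proof -
  define f where "f = (\<lambda>x\<in>carrier G. \<phi> (SOME C. C \<in> \<C> \<and> x \<in> C) x)"
  have f: "f x = \<phi> C x" if "C \<in> \<C>" "x \<in> C" for C x
  proof -
    have "(SOME C. C \<in> \<C> \<and> x \<in> C) \<in> \<C> \<and> x \<in> (SOME C. C \<in> \<C> \<and> x \<in> C)"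
      by (rule someI[of _ C]) (use that in auto)
    then have "\<phi> (SOME C. C \<in> \<C> \<and> x \<in> C) x = \<phi> C x" using that by (intro agree) auto
    then show ?thesis using cover_mem_carrier[OF that] by (simp add: f_def)
  qed
  have "f \<in> carrier R"
    by (rule R_memI) (use f e subgroup.m_closed[OF cover_subgroup] in \<open>auto simp: endo_on_iff f_def\<close>)
  then show ?thesis using f by blast
qed

lemma pts_cases:
  obtains "pts E = {}" | K where "pts E = {K}" | "card (pts E) \<ge> 2"
  by (metis One_nat_def Suc_1 Suc_leI card_1_singletonE card_gt_0_iff le_neq_implies_less pts_finite)

text \<open>The converse of \<open>linked_expo\<close>: constancy along \<open>linked\<close> is the
  only restriction on the eigenvalues. With three or more points a power map works; with two, their
  generators form a basis, whose images are free.\<close>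

lemma ex_ele_endo:
  assumes E: "E \<in> ele" and two: "card (pts E) \<ge> 2"
    and l: "\<And>K K'. (K, K') \<in> linked \<Longrightarrow> l K = (l K' :: int)"
  shows "\<exists>\<psi>. endo_on E \<psi> \<and> (\<forall>K\<in>pts E. \<forall>x\<in>K. \<psi> x = x [^] l K)"
proof (cases "card (pts E) \<ge> 3")
  case True
  then obtain K where K: "K \<in> pts E" by (metis all_not_in_conv card.empty not_numeral_le_zero)
  have "l K' = l K" if "K' \<in> pts E" for K'
    using that K True E by (intro l) (auto simp: linked_def)
  then show ?thesis
    using endo_on_int_pow_fun[OF cover_subgroup[OF eleD(1)[OF E]] cover_commute[OF eleD(1)[OF E]]]
    by (intro exI[of _ "\<lambda>x. x [^] l K"]) auto
next
  case False
  then have "card (pts E) = 2" using two by simp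
  then obtain K K' where K: "pts E = {K, K'}" "K \<noteq> K'" by (auto simp: card_2_iff)
  then have B: "basis E (gen K) (gen K')" using pts_basis[OF E] by auto
  have s: "subgroup E G" using E eleD cover_subgroup by blast
  obtain \<psi> where \<psi>: "endo_on E \<psi>" "\<psi> (gen K) = gen K [^] l K" "\<psi> (gen K') = gen K' [^] l K'"
    using ex_endo_on[OF B, of "gen K [^] l K" "gen K' [^] l K'"] B subgroup_int_pow_closed[OF s]
    by (auto simp: basis_def)
  have "\<psi> x = x [^] l L" if LE: "L \<in> pts E" "x \<in> L" for L x
  proof -
    have L: "L \<in> points" using LE ptsD by auto
    then obtain i :: int where i: "x = gen L [^] i" using point_elt[OF L LE(2)] by blast
    have "gen L \<in> E" using gen(1)[OF L] ptsD(2)[OF LE(1)] by auto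
    then have "\<psi> x = \<psi> (gen L) [^] i" using i endo_on_int_pow[OF s \<psi>(1)] by simp
    also have "\<psi> (gen L) = gen L [^] l L" using \<psi> LE K by auto
    finally show ?thesis using i gen(4)[OF L] by (simp add: int_pow_pow mult.commute)
  qed
  then show ?thesis using \<psi>(1) by blast
qed

text \<open>The existence half of every surjectivity proof below. The data are the eigenvalues l on
  points, the exponents u on maximal cyclic subgroups, and the endomorphisms v of elementary abelian
  members. The values of v are used only on members with at most one point, since with more points l
  already determines the endomorphism.\<close>

lemma construct:
  fixes l u :: "'a set \<Rightarrow> int" and v :: "'a set \<Rightarrow> 'a \<Rightarrow> 'a"
  assumes l: "\<And>K K'. (K, K') \<in> linked \<Longrightarrow> l K = l K'"
    and u: "\<And>K M x. K \<in> points \<Longrightarrow> M \<in> MC K \<Longrightarrow> x \<in> K \<Longrightarrow> x [^] u M = x [^] l K"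
    and uu: "\<And>K M M' x. K \<in> points \<Longrightarrow> M \<in> MC K \<Longrightarrow> M' \<in> MC K \<Longrightarrow> x \<in> M \<Longrightarrow> x \<in> M' \<Longrightarrow> x [^] u M = x [^] u M'"
    and v: "\<And>E. E \<in> ele \<Longrightarrow> endo_on E (v E)"
    and vl: "\<And>E K x. E \<in> ele \<Longrightarrow> pts E = {K} \<Longrightarrow> x \<in> K \<Longrightarrow> v E x = x [^] l K"
  shows "\<exists>f\<in>carrier R. (\<forall>K\<in>points. \<forall>M\<in>MC K. \<forall>x\<in>M. f x = x [^] u M) \<and>
    (\<forall>E\<in>ele. card (pts E) \<le> 1 \<longrightarrow> (\<forall>x\<in>E. f x = v E x))"
proof -
  have "\<forall>E. \<exists>\<psi>. E \<in> ele \<and> card (pts E) \<ge> 2 \<longrightarrow> endo_on E \<psi> \<and> (\<forall>K\<in>pts E. \<forall>x\<in>K. \<psi> x = x [^] l K)"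
    using ex_ele_endo l by meson
  then obtain \<psi> where \<psi>: "\<And>E. E \<in> ele \<Longrightarrow> card (pts E) \<ge> 2 \<Longrightarrow> endo_on E (\<psi> E)"
    "\<And>E K x. E \<in> ele \<Longrightarrow> card (pts E) \<ge> 2 \<Longrightarrow> K \<in> pts E \<Longrightarrow> x \<in> K \<Longrightarrow> \<psi> E x = x [^] l K"
    by metis
  define \<phi> where "\<phi> C = (if C \<in> cyc then (\<lambda>x. x [^] u C) else if card (pts C) \<le> 1 then v C else \<psi> C)" for C
  have endo: "endo_on C (\<phi> C)" if C: "C \<in> \<C>" for C
    using cover_cases[OF C] endo_on_int_pow_fun[OF cover_subgroup[OF C] cover_commute[OF C]] v[of C] \<psi>(1)[of C]
    by (auto simp: \<phi>_def)
  \<comment> \<open>Whatever the type of the member C, it acts on each of its points by l. This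
    settles agreement for every pair of members that are not both cyclic.\<close>
  have on_points: "\<phi> C x = x [^] l K" if C: "C \<in> \<C>" "K \<in> points" "K \<subseteq> C" "x \<in> K" for C K x
  proof (cases "C \<in> cyc")
    case True
    then show ?thesis using u[OF C(2) cyc_MC C(4)] C by (simp add: \<phi>_def)
  next
    case False
    then have E: "C \<in> ele" using cover_cases C by blast
    have K: "K \<in> pts C" using C by (simp add: pts_def)
    show ?thesis
    proof (cases rule: pts_cases[of C])
      case 1
      then show ?thesis using K by simp
    next
      case (2 K')
      then show ?thesis using K vl[OF E, of K x] C False by (simp add: \<phi>_def)
    next
      case 3
      then show ?thesis using \<psi>(2)[OF E 3 K C(4)] False by (simp add: \<phi>_def)
    qed
  qed
  have agree: "\<phi> C x = \<phi> C' x" if C: "C \<in> \<C>" "C' \<in> \<C>" and x: "x \<in> C" "x \<in> C'" for C C' x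
  proof (cases "x = \<one> \<or> C = C'")
    case True
    then show ?thesis using endo_on_one[OF cover_subgroup endo] C by auto
  next
    case False
    show ?thesis
    proof (cases "C \<in> cyc \<and> C' \<in> cyc")
      case True
      then obtain K where "K \<in> points" "C \<in> MC K" "C' \<in> MC K" using cyc_inter_point[of C C' x] x False by auto
      then show ?thesis using uu[of K C C' x] True x by (simp add: \<phi>_def)
    next
      case neither: False
      have "\<exists>K\<in>points. x \<in> K \<and> K \<subseteq> C \<and> K \<subseteq> C'"
        using neither cover_cases[OF C(1)] cover_cases[OF C(2)] ele_inter_point[of C C' x] ele_inter_point[of C' C x] C x False
        by blast
      then obtain K where "K \<in> points" "x \<in> K" "K \<subseteq> C" "K \<subseteq> C'" by blast
      then show ?thesis using on_points C by metis
    qed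
  qed
  obtain f where f: "f \<in> carrier R" "\<And>C x. C \<in> \<C> \<Longrightarrow> x \<in> C \<Longrightarrow> f x = \<phi> C x"
    using glue[OF endo agree] by blast
  have "f x = x [^] u M" if K: "K \<in> points" "M \<in> MC K" "x \<in> M" for K M x
    using MC_cases[OF K(1,2)]
  proof
    assume M: "M \<in> cyc"
    then show ?thesis using f(2)[OF cycD(1)[OF M] K(3)] by (simp add: \<phi>_def)
  next
    \<comment> \<open>Here M may lie outside the cover, so f is read off from any member containing
      K; the hypothesis on u then turns l into u.\<close>
    assume MK: "M = K"
    obtain C where C: "C \<in> \<C>" "K \<subseteq> C" using points_cover K by blast
    then have "f x = x [^] l K" using f(2)[OF C(1), of x] on_points[OF C(1) K(1) C(2), of x] K MK by auto
    then show ?thesis using u[OF K(1,2), of x] K MK by simp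
  qed
  moreover have "f x = v E x" if "E \<in> ele" "card (pts E) \<le> 1" "x \<in> E" for E x
    using f(2)[OF eleD(1)[OF that(1)] that(3)] ele_not_cyc[OF that(1)] that(2) by (simp add: \<phi>_def)
  ultimately show ?thesis using f(1) by blast
qed

end

section \<open>The factors of the cover ring\<close>

context star_cover
begin

text \<open>Since \<open>linked\<close> is symmetric, its reflexive transitive closure is an
  equivalence. A point linked to no other point is a class of its own.\<close>

definition cls :: "'a set \<Rightarrow> 'a set set" where
  "cls K = linked\<^sup>* `` {K}"

text \<open>The part of G that the component of a class controls. Planes with several points are
  left out, because the values on their points already determine the values there.\<close>

definition supp :: "'a set set \<Rightarrow> 'a set" where
  "supp c = (\<Union>K\<in>c. \<Union>(MC K)) \<union> \<Union>{E \<in> ele. \<exists>K\<in>c. pts E = {K}}"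

text \<open>Components are indexed by their supports. This identifies the different representatives
  of a class and gives both kinds of component the same type of index.\<close>

definition comps :: "'a set set" where
  "comps = (\<lambda>K. supp (cls K)) ` points \<union> {E \<in> ele. pts E = {}}"

lemma ele_carrier: "E \<in> ele \<Longrightarrow> E \<subseteq> carrier G"
  using eleD(1) cover_mem_carrier by blast

lemma supp_carrier: "supp c \<subseteq> carrier G"
  using MC_D(3) subgroup.subset ele_carrier by (fastforce simp: supp_def)

lemma cls_refl: "K \<in> cls K"
  by (simp add: cls_def)

lemma cls_eq: "K' \<in> cls K \<Longrightarrow> cls K' = cls K"
proof -
  assume "K' \<in> cls K"
  then have "(K, K') \<in> linked\<^sup>*" by (simp add: cls_def)
  moreover have "sym (linked\<^sup>*)" by (rule sym_rtrancl) (auto simp: sym_def linked_def)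
  ultimately show ?thesis by (auto simp: cls_def sym_def dest: rtrancl_trans)
qed

lemma cls_linked: "(K1, K2) \<in> linked \<Longrightarrow> K1 \<in> cls K \<longleftrightarrow> K2 \<in> cls K"
  by (metis Image_singleton_iff cls_def cls_eq cls_refl r_into_rtrancl)

lemma cls_points:
  assumes "K \<in> points" shows "cls K \<subseteq> points"
proof
  fix K' assume "K' \<in> cls K"
  then have "(K, K') \<in> linked\<^sup>*" by (simp add: cls_def)
  then show "K' \<in> points" using assms by (induction) (auto simp: linked_def pts_def)
qed

lemma cls_expo:
  assumes "K' \<in> cls K" "f \<in> carrier R" shows "expo K' f = expo K f"
proof -
  have "(K, K') \<in> linked\<^sup>*" using assms by (simp add: cls_def)
  then show ?thesis using linked_expo[OF _ assms(2)] by induction auto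
qed

lemma expo_apply:
  "K \<in> points \<Longrightarrow> M \<in> MC K \<Longrightarrow> f \<in> carrier R \<Longrightarrow> x \<in> M \<Longrightarrow> f x = x [^] expo M f"
  using expo endo_MC MC_D by blast

lemma expo_point:
  "K \<in> points \<Longrightarrow> f \<in> carrier R \<Longrightarrow> x \<in> K \<Longrightarrow> f x = x [^] expo K f"
  using expo endo_point points_cyclic by blast

text \<open>Composing power maps multiplies exponents and adding them adds exponents. The reduction
  of 1 matters for the trivial subgroup, where the exponent of the identity map is 0.\<close>

lemma expo_R:
  assumes M: "cyclic_subgroup M G" and f: "f \<in> carrier R" "endo_on M f" and g: "g \<in> carrier R" "endo_on M g"
  shows "expo M (f \<otimes>\<^bsub>R\<^esub> g) = (expo M f * expo M g) mod int (card M)"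
    and "expo M (f \<oplus>\<^bsub>R\<^esub> g) = (expo M f + expo M g) mod int (card M)"
    and "expo M \<one>\<^bsub>R\<^esub> = 1 mod int (card M)"
proof -
  have s: "subgroup M G" using M by (simp add: cyclic_subgroup_def)
  note c = subgroup.mem_carrier[OF s]
  have "(f \<otimes>\<^bsub>R\<^esub> g) x = x [^] (expo M f * expo M g)" if x: "x \<in> M" for x
  proof -
    have "(f \<otimes>\<^bsub>R\<^esub> g) x = g x [^] expo M f"
      using expo[OF M f(2)] g(2) x c by (simp add: R_apply endo_on_iff)
    then show ?thesis using expo[OF M g(2) x] c[OF x] by (simp add: int_pow_pow mult.commute)
  qed
  then show "expo M (f \<otimes>\<^bsub>R\<^esub> g) = (expo M f * expo M g) mod int (card M)" by (rule expo_eqI[OF M])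
  have "(f \<oplus>\<^bsub>R\<^esub> g) x = x [^] (expo M f + expo M g)" if x: "x \<in> M" for x
    using expo[OF M f(2) x] expo[OF M g(2) x] c[OF x] by (simp add: R_apply int_pow_mult)
  then show "expo M (f \<oplus>\<^bsub>R\<^esub> g) = (expo M f + expo M g) mod int (card M)" by (rule expo_eqI[OF M])
  show "expo M \<one>\<^bsub>R\<^esub> = 1 mod int (card M)"
    by (rule expo_eqI[OF M]) (simp add: R_apply c)
qed

text \<open>The joint kernel is zero. A nontrivial element of a cyclic member, or any element of a
  plane with at most one point, lies in a support. A plane with more points is spanned by two of
  them, and points lie in supports through the maximal cyclic subgroups above them.\<close>

lemma supp_cover:
  assumes f: "f \<in> carrier R" and t: "\<And>Y x. Y \<in> comps \<Longrightarrow> x \<in> Y \<Longrightarrow> f x = \<one>"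
  shows "f = \<zero>\<^bsub>R\<^esub>"
proof -
  interpret R: ring R by (rule R_ring)
  have on_MC: "f x = \<one>" if "K \<in> points" "M \<in> MC K" "x \<in> M" for K M x
    using that cls_refl by (intro t[of "supp (cls K)"]) (auto simp: comps_def supp_def)
  show ?thesis
  proof (rule R_ext[OF f R.zero_closed])
    fix x assume x: "x \<in> carrier G"
    then obtain C where C: "C \<in> \<C>" "x \<in> C" using cover_ex by blast
    have "f x = \<one>"
    proof (cases "x = \<one>")
      case True
      then show ?thesis using endo_on_one[OF cover_subgroup R_endo[OF f]] C by blast
    next
      case False
      show ?thesis
      proof (cases "C \<in> cyc")
        case True
        then show ?thesis using cyc_point[OF True C(2) False] on_MC C by blast
      next
        case False
        then have E: "C \<in> ele" using C cover_cases by blast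
        show ?thesis
        proof (cases rule: pts_cases[of C])
          case 1
          then show ?thesis using E C by (intro t[of C]) (auto simp: comps_def)
        next
          case (2 K)
          then have "K \<in> points" using ptsD by auto
          then show ?thesis using 2 E C cls_refl by (intro t[of "supp (cls K)"]) (auto simp: comps_def supp_def)
        next
          case 3
          then have "\<not> card (pts C) \<le> Suc 0" by simp
          then obtain K K' where K: "K \<in> pts C" "K' \<in> pts C" "K \<noteq> K'"
            using card_le_Suc0_iff_eq[OF pts_finite] by blast
          have B: "basis C (gen K) (gen K')" using pts_basis[OF E K] .
          have "f (gen L) = \<one>" if "L \<in> pts C" for L
          proof -
            have L: "L \<in> points" using that ptsD by auto
            then obtain M where "M \<in> MC L" using MC_nonempty by blast
            then show ?thesis using on_MC[OF L] MC_D(2) gen(1)[OF L] by blast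
          qed
          then have "f (gen K) = \<one>" "f (gen K') = \<one>" using K by auto
          then show ?thesis
            using endo_on_comb[OF _ _ _ R_endo[OF f C(1)], of "gen K" "gen K'"] crd(1)[OF B C(2)] B
            by (simp add: basis_def) (metis comb_def int_pow_one l_one one_closed)
        qed
      qed
    qed
    then show "f x = \<zero>\<^bsub>R\<^esub> x" using x by (simp add: R_apply)
  qed
qed

text \<open>The hypothesis \<open>eq\<close> compares two values of h instead of testing for zero,
  because \<open>T\<close> is not assumed to be a ring. The kernel appears only after the passage to
  the copy \<open>F\<close>, which is one.\<close>

lemma component_from_hom:
  fixes T :: "('c, 'd) ring_scheme"
  assumes h: "h \<in> Ring.ring_hom R T"
    and eq: "\<And>f g. f \<in> carrier R \<Longrightarrow> g \<in> carrier R \<Longrightarrow> h f = h g \<longleftrightarrow> (\<forall>x\<in>Y. f x = g x)"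
    and surj: "\<And>y. y \<in> carrier T \<Longrightarrow> \<exists>f\<in>carrier R. h f = y \<and> (\<forall>Y'\<in>comps - {Y}. \<forall>x\<in>Y'. f x = \<one>)"
    and Y: "Y \<subseteq> carrier G"
  shows "\<exists>(F :: nat ring) k. ring F \<and> F \<simeq> T \<and> k \<in> Ring.ring_hom R F \<and>
    (\<forall>f\<in>carrier R. k f = \<zero>\<^bsub>F\<^esub> \<longleftrightarrow> (\<forall>x\<in>Y. f x = \<one>)) \<and>
    (\<forall>y\<in>carrier F. \<exists>f\<in>carrier R. k f = y \<and> (\<forall>Y'\<in>comps - {Y}. \<forall>x\<in>Y'. f x = \<one>))"
proof -
  interpret R: ring R by (rule R_ring)
  have onto: "h ` carrier R = carrier T" using surj ring_hom_closed[OF h] by blast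
  obtain F :: "nat ring" and k where F: "ring F" "k \<in> Ring.ring_hom R F" "k ` carrier R = carrier F" "F \<simeq> T"
    "\<And>r s. r \<in> carrier R \<Longrightarrow> s \<in> carrier R \<Longrightarrow> k r = k s \<longleftrightarrow> h r = h s"
    using ring_hom_countable_image[OF R_ring h onto R_finite] by blast
  have "k \<zero>\<^bsub>R\<^esub> = \<zero>\<^bsub>F\<^esub>" using ring_hom_zero[OF F(2) R_ring F(1)] .
  then have "k f = \<zero>\<^bsub>F\<^esub> \<longleftrightarrow> (\<forall>x\<in>Y. f x = \<one>)" if "f \<in> carrier R" for f
    using F(5)[OF that R.zero_closed] eq[OF that R.zero_closed] Y by (auto simp: R_apply subset_iff)
  moreover have "\<exists>f\<in>carrier R. k f = y \<and> (\<forall>Y'\<in>comps - {Y}. \<forall>x\<in>Y'. f x = \<one>)" if y: "y \<in> carrier F" for y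
  proof -
    obtain g where g: "g \<in> carrier R" "y = k g" using y F(3) by auto
    obtain f where f: "f \<in> carrier R" "h f = h g" "\<forall>Y'\<in>comps - {Y}. \<forall>x\<in>Y'. f x = \<one>"
      using surj[OF ring_hom_closed[OF h g(1)]] by blast
    then show ?thesis using F(5)[OF f(1) g(1)] g by auto
  qed
  ultimately show ?thesis using F by blast
qed

text \<open>The coordinates of f a and f b are the columns of the matrix of f on E. The first two
  equations say that this matrix acts on the coordinate column of g x.\<close>

lemma crd_mult:
  assumes B: "basis E a b" and E: "E \<in> ele" and f: "f \<in> carrier R" and g: "g \<in> carrier R" and x: "x \<in> E"
  shows "crd1 a b ((f \<otimes>\<^bsub>R\<^esub> g) x) =
      (crd1 a b (f a) * crd1 a b (g x) + crd1 a b (f b) * crd2 a b (g x)) mod int p"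
    and "crd2 a b ((f \<otimes>\<^bsub>R\<^esub> g) x) =
      (crd2 a b (f a) * crd1 a b (g x) + crd2 a b (f b) * crd2 a b (g x)) mod int p"
    and "crd1 a b ((f \<oplus>\<^bsub>R\<^esub> g) x) = (crd1 a b (f x) + crd1 a b (g x)) mod int p"
    and "crd2 a b ((f \<oplus>\<^bsub>R\<^esub> g) x) = (crd2 a b (f x) + crd2 a b (g x)) mod int p"
proof -
  have ab: "elab E" "a \<in> E" "b \<in> E" using B by (auto simp: basis_def)
  note EC = eleD(1)[OF E]
  have cl: "f y \<in> E" "g y \<in> E" if "y \<in> E" for y using R_cover_closed EC f g that by auto
  have xc: "x \<in> carrier G" using cover_mem_carrier[OF EC x] .
  have abc: "a \<in> carrier G" "b \<in> carrier G" using elabD(5) ab by auto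
  let ?s = "crd1 a b (g x)" and ?t = "crd2 a b (g x)"
  have "(f \<otimes>\<^bsub>R\<^esub> g) x = f (g x)" using xc by (simp add: R_apply)
  also have "\<dots> = f (comb a b ?s ?t)" using crd(1)[OF B cl(2)[OF x]] by simp
  also have "\<dots> = comb (f a) (f b) ?s ?t" using endo_on_comb[OF ab R_endo[OF f EC]] .
  also have "\<dots> = f a [^] ?s \<otimes> f b [^] ?t" by (simp add: comb_def)
  also have "\<dots> = comb a b (crd1 a b (f a)) (crd2 a b (f a)) [^] ?s \<otimes> comb a b (crd1 a b (f b)) (crd2 a b (f b)) [^] ?t"
    using crd(1)[OF B cl(1)[OF ab(2)]] crd(1)[OF B cl(1)[OF ab(3)]] by simp
  also have "\<dots> = comb a b (crd1 a b (f a) * ?s + crd1 a b (f b) * ?t) (crd2 a b (f a) * ?s + crd2 a b (f b) * ?t)"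
    by (simp add: comb_pow[OF ab] comb_mult[OF ab])
  finally show "crd1 a b ((f \<otimes>\<^bsub>R\<^esub> g) x) =
      (crd1 a b (f a) * crd1 a b (g x) + crd1 a b (f b) * crd2 a b (g x)) mod int p"
    "crd2 a b ((f \<otimes>\<^bsub>R\<^esub> g) x) =
      (crd2 a b (f a) * crd1 a b (g x) + crd2 a b (f b) * crd2 a b (g x)) mod int p"
    by (simp_all add: crd_comb[OF B])
  have "(f \<oplus>\<^bsub>R\<^esub> g) x = comb a b (crd1 a b (f x)) (crd2 a b (f x)) \<otimes> comb a b ?s ?t"
    using xc crd(1)[OF B cl(1)[OF x]] crd(1)[OF B cl(2)[OF x]] by (simp add: R_apply)
  also have "\<dots> = comb a b (crd1 a b (f x) + ?s) (crd2 a b (f x) + ?t)" by (rule comb_mult[OF ab])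
  finally show "crd1 a b ((f \<oplus>\<^bsub>R\<^esub> g) x) = (crd1 a b (f x) + crd1 a b (g x)) mod int p"
    "crd2 a b ((f \<oplus>\<^bsub>R\<^esub> g) x) = (crd2 a b (f x) + crd2 a b (g x)) mod int p"
    by (simp_all add: crd_comb[OF B])
qed

lemma basis_comb:
  assumes B: "basis E a b" shows "a = comb a b 1 0" "b = comb a b 0 1"
  using B elabD(5) by (auto simp: basis_def comb_def)

lemma basis_eq_on:
  assumes B: "basis E a b" and E: "E \<in> ele" and f: "f \<in> carrier R" and g: "g \<in> carrier R"
    and ab: "f a = g a" "f b = g b" and x: "x \<in> E"
  shows "f x = g x"
proof -
  have *: "elab E" "a \<in> E" "b \<in> E" using B by (auto simp: basis_def)
  show ?thesis
    using endo_on_comb[OF * R_endo[OF f eleD(1)[OF E]]] endo_on_comb[OF * R_endo[OF g eleD(1)[OF E]]]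
      crd(1)[OF B x] ab by metis
qed

lemma crd_eqI:
  assumes "basis E a b" "x \<in> E" "y \<in> E" "crd1 a b x = crd1 a b y" "crd2 a b x = crd2 a b y"
  shows "x = y"
  using assms crd(1) by metis

text \<open>Without points, E meets the other members only in the identity, so any endomorphism of E
  extends to G by the trivial map elsewhere.\<close>

lemma free_component:
  assumes E: "E \<in> ele" and free: "pts E = {}"
  shows "\<exists>(F :: nat ring) k. ring F \<and> F \<simeq> matrix_ring (residue_ring (int p)) 2 \<and> k \<in> Ring.ring_hom R F \<and>
    (\<forall>f\<in>carrier R. k f = \<zero>\<^bsub>F\<^esub> \<longleftrightarrow> (\<forall>x\<in>E. f x = \<one>)) \<and>
    (\<forall>y\<in>carrier F. \<exists>f\<in>carrier R. k f = y \<and> (\<forall>Y'\<in>comps - {E}. \<forall>x\<in>Y'. f x = \<one>))"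
proof -
  let ?T = "matrix_ring (residue_ring (int p)) 2"
  have el: "elab E" using E eleD by simp
  have "card E \<noteq> 1" using elabD(4)[OF el] p_pos by (simp add: power2_eq_square)
  then have "E \<noteq> {\<one>}" by auto
  then obtain a where "a \<in> E" "a \<noteq> \<one>" using subgroup.one_closed[OF elabD(1)[OF el]] by blast
  then obtain b where B: "basis E a b" using elab_ex_basis[OF el] by blast
  then have ab: "a \<in> E" "b \<in> E" by (auto simp: basis_def)
  \<comment> \<open>The matrix of f on E: column 0 holds the coordinates of f a, column 1 those of f
    b.\<close>
  define h where "h f = mat 2 2 (\<lambda>(i, j). let x = f (if j = 0 then a else b) in if i = 0 then crd1 a b x else crd2 a b x)"
    for f
  have hc [simp]: "h f \<in> carrier_mat 2 2" for f by (simp add: h_def)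
  have hd [simp]: "dim_row (h f) = 2" "dim_col (h f) = 2" for f by (simp_all add: h_def)
  have lt2: "i < 2 \<longleftrightarrow> i = 0 \<or> i = Suc 0" for i :: nat by auto
  have hi: "h f $$ (0, 0) = crd1 a b (f a)" "h f $$ (0, Suc 0) = crd1 a b (f b)"
    "h f $$ (Suc 0, 0) = crd2 a b (f a)" "h f $$ (Suc 0, Suc 0) = crd2 a b (f b)" for f
    by (simp_all add: h_def Let_def)
  have cl: "f a \<in> E" "f b \<in> E" if "f \<in> carrier R" for f using R_cover_closed that eleD(1)[OF E] ab by auto
  interpret R: ring R by (rule R_ring)
  show ?thesis
  proof (rule component_from_hom)
    show "h \<in> Ring.ring_hom R ?T"
    proof (rule ring_hom_memI)
      fix f g assume f: "f \<in> carrier R" and g: "g \<in> carrier R"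
      show "h f \<in> carrier ?T"
        using crd(2-)[OF B cl(1)[OF f]] crd(2-)[OF B cl(2)[OF f]] by (auto simp: matrix_ring_def lt2 hi)
      have "h (f \<otimes>\<^bsub>R\<^esub> g) = map_mat (\<lambda>x. x mod int p) (h f * h g)"
      proof (rule eq_matI)
        fix i j assume "i < dim_row (map_mat (\<lambda>x. x mod int p) (h f * h g))" "j < dim_col (map_mat (\<lambda>x. x mod int p) (h f * h g))"
        then have ij: "i < 2" "j < 2" using hc[of f] hc[of g] by auto
        then have "(h f * h g) $$ (i, j) = h f $$ (i, 0) * h g $$ (0, j) + h f $$ (i, Suc 0) * h g $$ (Suc 0, j)"
          using hc[of f] hc[of g] by (simp add: scalar_prod_def numeral_2_eq_2)
        then show "h (f \<otimes>\<^bsub>R\<^esub> g) $$ (i, j) = map_mat (\<lambda>x. x mod int p) (h f * h g) $$ (i, j)"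
          using ij hc[of f] hc[of g] by (auto simp: lt2 hi crd_mult[OF B E f g ab(1)] crd_mult[OF B E f g ab(2)])
      qed (use hc[of f] hc[of g] in \<open>auto simp: h_def\<close>)
      then show "h (f \<otimes>\<^bsub>R\<^esub> g) = h f \<otimes>\<^bsub>?T\<^esub> h g" using p_pos by (simp add: matrix_ring_mult)
      have "h (f \<oplus>\<^bsub>R\<^esub> g) = map_mat (\<lambda>x. x mod int p) (h f + h g)"
      proof (rule eq_matI)
        fix i j assume "i < dim_row (map_mat (\<lambda>x. x mod int p) (h f + h g))" "j < dim_col (map_mat (\<lambda>x. x mod int p) (h f + h g))"
        then have ij: "i < 2" "j < 2" using hc[of f] hc[of g] by auto
        then show "h (f \<oplus>\<^bsub>R\<^esub> g) $$ (i, j) = map_mat (\<lambda>x. x mod int p) (h f + h g) $$ (i, j)"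
          using hc[of f] hc[of g] by (auto simp: lt2 hi crd_mult[OF B E f g ab(1)] crd_mult[OF B E f g ab(2)])
      qed (use hc[of f] hc[of g] in \<open>auto simp: h_def\<close>)
      then show "h (f \<oplus>\<^bsub>R\<^esub> g) = h f \<oplus>\<^bsub>?T\<^esub> h g" by (simp add: matrix_ring_add)
    next
      have "crd1 a b a = 1" "crd2 a b a = 0" "crd1 a b b = 0" "crd2 a b b = 1"
        using crd_comb[OF B, of 1 0] crd_comb[OF B, of 0 1] basis_comb[OF B, symmetric] p_pos by auto
      moreover have "a \<in> carrier G" "b \<in> carrier G" using ab elabD(5)[OF el] by auto
      ultimately show "h \<one>\<^bsub>R\<^esub> = \<one>\<^bsub>?T\<^esub>"
        unfolding matrix_ring_one
        by (intro eq_matI) (auto simp: lt2 hi R_apply h_def)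
    qed
  next
    fix f g assume f: "f \<in> carrier R" and g: "g \<in> carrier R"
    show "h f = h g \<longleftrightarrow> (\<forall>x\<in>E. f x = g x)"
    proof
      assume "h f = h g"
      then have "f a = g a" "f b = g b"
        using hi[of f] hi[of g] crd_eqI[OF B cl(1)[OF f] cl(1)[OF g]] crd_eqI[OF B cl(2)[OF f] cl(2)[OF g]] by simp_all
      then show "\<forall>x\<in>E. f x = g x" using basis_eq_on[OF B E f g] by blast
    qed (use ab in \<open>simp add: h_def\<close>)
  next
    fix y assume y: "y \<in> carrier ?T"
    define s where "s j = comb a b (y $$ (0, j)) (y $$ (Suc 0, j))" for j
    have sE: "s j \<in> E" for j using comb_closed[OF el ab] by (simp add: s_def)
    obtain w where w: "endo_on E w" "w a = s 0" "w b = s (Suc 0)" using ex_endo_on[OF B sE sE] by metis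
    \<comment> \<open>Eigenvalue and exponent 0 mean the trivial map, so only E carries a prescribed
      action.\<close>
    have "\<exists>f\<in>carrier R. (\<forall>K\<in>points. \<forall>M\<in>MC K. \<forall>x\<in>M. f x = x [^] (0::int)) \<and>
        (\<forall>E'\<in>ele. card (pts E') \<le> 1 \<longrightarrow> (\<forall>x\<in>E'. f x = (if E' = E then w else (\<lambda>_. \<one>)) x))"
      by (rule construct[of "\<lambda>_. 0" "\<lambda>_. 0" "\<lambda>E'. if E' = E then w else (\<lambda>_. \<one>)"])
        (use w(1) free endo_on_trivial[OF cover_subgroup[OF eleD(1)]] in auto)
    then obtain f where f0: "f \<in> carrier R" "\<forall>K\<in>points. \<forall>M\<in>MC K. \<forall>x\<in>M. f x = x [^] (0::int)"
        "\<forall>E'\<in>ele. card (pts E') \<le> 1 \<longrightarrow> (\<forall>x\<in>E'. f x = (if E' = E then w else (\<lambda>_. \<one>)) x)"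
      by (elim bexE conjE) (rule that)
    have f: "f \<in> carrier R" "\<And>K M x. K \<in> points \<Longrightarrow> M \<in> MC K \<Longrightarrow> x \<in> M \<Longrightarrow> f x = \<one>"
        "\<And>E' x. E' \<in> ele \<Longrightarrow> card (pts E') \<le> 1 \<Longrightarrow> x \<in> E' \<Longrightarrow> f x = (if E' = E then w x else \<one>)"
      using f0 by auto
    have fa: "f a = s 0" "f b = s (Suc 0)" using f(3)[OF E, of a] f(3)[OF E, of b] free ab w by auto
    have "h f = y"
    proof (rule eq_matI)
      fix i j assume "i < dim_row y" "j < dim_col y"
      moreover have "y \<in> carrier_mat 2 2" "\<forall>i<2. \<forall>j<2. y $$ (i, j) \<in> {0..<int p}" using y by (auto simp: matrix_ring_def)
      ultimately have "i < 2" "j < 2" "y $$ (i, j) mod int p = y $$ (i, j)" by auto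
      then show "h f $$ (i, j) = y $$ (i, j)" by (auto simp: lt2 hi fa s_def crd_comb[OF B])
    qed (use y in \<open>auto simp: matrix_ring_def h_def\<close>)
    moreover have "f x = \<one>" if Y': "Y' \<in> comps - {E}" "x \<in> Y'" for Y' x
    proof -
      \<comment> \<open>Every other support consists of elements above points and of elements of
        other planes with exactly one or no point; f is trivial on both.\<close>
      from Y' consider K K' M where "K \<in> points" "K' \<in> cls K" "M \<in> MC K'" "x \<in> M"
        | E' where "E' \<in> ele" "E' \<noteq> E" "card (pts E') \<le> 1" "x \<in> E'"
        using free by (fastforce simp: comps_def supp_def)
      then show ?thesis
      proof cases
        case 1
        then show ?thesis using cls_points[OF 1(1)] f(2) by blast
      next
        case 2
        then show ?thesis using f(3) by simp
      qed
    qed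
    ultimately show "\<exists>f\<in>carrier R. h f = y \<and> (\<forall>Y'\<in>comps - {E}. \<forall>x\<in>Y'. f x = \<one>)" using f(1) by blast
  qed (use elabD(5)[OF el] in auto)
qed

end

context star_cover
begin

section \<open>The component of a class of points\<close>

context
  fixes K0 :: "'a set" and Ks Es :: "'a set list"
  assumes K0: "K0 \<in> points"
    and Ks: "set Ks = cls K0" "distinct Ks"
    and Es: "set Es = {E \<in> ele. \<exists>K\<in>cls K0. pts E = {K}}" "distinct Es"
begin

definition pt :: "'a set \<Rightarrow> 'a set" where "pt E = the_elem (pts E)"

definition base1 :: "'a set \<Rightarrow> 'a" where "base1 E = gen (pt E)"

text \<open>Any complement of the eigenline will do. With \<open>base1\<close> spanning the only
  point of E, the matrix of f on E becomes upper triangular.\<close>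

definition base2 :: "'a set \<Rightarrow> 'a" where "base2 E = (SOME b. basis E (base1 E) b)"

text \<open>A position counted from 0, while the index list counts rows from 1; hence the successor
  in \<open>row\<close>.\<close>

definition pos :: "'a set \<Rightarrow> nat" where "pos K = (SOME i. i < length Ks \<and> Ks ! i = K)"

abbreviation (input) row :: "'a set \<Rightarrow> nat" where "row E \<equiv> Suc (pos (pt E))"

text \<open>\<open>nu\<close> and \<open>mu\<close> form the second column of the matrix of f on E;
  the first column is \<open>lam f\<close> above 0.\<close>

abbreviation (input) nu :: "('a \<Rightarrow> 'a) \<Rightarrow> 'a set \<Rightarrow> int" where
  "nu f E \<equiv> crd1 (base1 E) (base2 E) (f (base2 E))"

abbreviation (input) mu :: "('a \<Rightarrow> 'a) \<Rightarrow> 'a set \<Rightarrow> int" where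
  "mu f E \<equiv> crd2 (base1 E) (base2 E) (f (base2 E))"

abbreviation (input) lam :: "('a \<Rightarrow> 'a) \<Rightarrow> int" where "lam f \<equiv> expo K0 f"

definition coords :: "('a \<Rightarrow> 'a) \<Rightarrow> int mat \<times> ('a set \<Rightarrow> int) list \<times> int list" where
  "coords f = (N_mat (length Ks) (map row Es) (lam f) (map (nu f) Es) (map (mu f) Es),
     map (\<lambda>K. \<lambda>M\<in>MC K. expo M f) Ks, map (mu f) Es)"

abbreviation (input) T :: "(int mat \<times> ('a set \<Rightarrow> int) list \<times> int list) ring" where
  "T \<equiv> S_ring p G (map row Es) Ks"

lemma Ks_points: "K \<in> set Ks \<Longrightarrow> K \<in> points"
  using Ks cls_points[OF K0] by blast

lemma Ks_expo: "K \<in> set Ks \<Longrightarrow> f \<in> carrier R \<Longrightarrow> expo K f = lam f"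
  using Ks cls_expo by blast

lemma K0_Ks: "K0 \<in> set Ks" "length Ks > 0"
proof -
  show "K0 \<in> set Ks" using Ks cls_refl by simp
  then show "length Ks > 0" by (rule length_pos_if_in_set)
qed

lemma Es_D:
  assumes "E \<in> set Es"
  shows "E \<in> ele" "pts E = {pt E}" "pt E \<in> set Ks" "pt E \<in> points" "basis E (base1 E) (base2 E)"
    "base1 E \<in> E" "base2 E \<in> E"
proof -
  obtain K where K: "E \<in> ele" "K \<in> set Ks" "pts E = {K}" using assms Es Ks by auto
  then show "E \<in> ele" "pts E = {pt E}" "pt E \<in> set Ks" by (auto simp: pt_def)
  then show "pt E \<in> points" using Ks_points by blast
  then have "base1 E \<in> E" "base1 E \<noteq> \<one>"
    using gen(1,2)[of "pt E"] ptsD(2)[of "pt E" E] \<open>pts E = {pt E}\<close> by (auto simp: base1_def)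
  then obtain b where "basis E (base1 E) b" using elab_ex_basis[OF eleD(2)[OF K(1)]] by blast
  then show B: "basis E (base1 E) (base2 E)" unfolding base2_def by (rule someI)
  then show "base1 E \<in> E" "base2 E \<in> E" by (auto simp: basis_def)
qed

lemma pos: "K \<in> set Ks \<Longrightarrow> pos K < length Ks \<and> Ks ! pos K = K"
  unfolding pos_def by (rule someI_ex) (auto simp: in_set_conv_nth)

lemma pos_nth: "i < length Ks \<Longrightarrow> pos (Ks ! i) = i"
  using pos[of "Ks ! i"] nth_eq_iff_index_eq[OF Ks(2), of "pos (Ks ! i)" i] by simp

lemma base1_apply:
  assumes E: "E \<in> set Es" and f: "f \<in> carrier R"
  shows "f (base1 E) = base1 E [^] lam f"
  using expo_point[OF Es_D(4)[OF E] f] Ks_expo[OF Es_D(3)[OF E] f] gen(1)[OF Es_D(4)[OF E]]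
  by (simp add: base1_def)

lemma lam_bounds: "f \<in> carrier R \<Longrightarrow> 0 \<le> lam f \<and> lam f < int p"
  using expo_bounds[OF points_cyclic[OF K0] endo_point[OF K0]] pointsD(2)[OF K0] by simp

lemma base2_apply_closed: "E \<in> set Es \<Longrightarrow> f \<in> carrier R \<Longrightarrow> f (base2 E) \<in> E"
  using R_cover_closed Es_D(1,7) eleD(1) by blast

lemma lam_R:
  assumes "f \<in> carrier R" "g \<in> carrier R"
  shows "lam (f \<otimes>\<^bsub>R\<^esub> g) = (lam f * lam g) mod int p" "lam (f \<oplus>\<^bsub>R\<^esub> g) = (lam f + lam g) mod int p"
  using expo_R(1,2)[OF points_cyclic[OF K0] assms(1) endo_point[OF K0 assms(1)] assms(2) endo_point[OF K0 assms(2)]]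
    pointsD(2)[OF K0] by simp_all

text \<open>The product of upper triangular 2 x 2 matrices with first columns (lam f, 0) and (lam g,
  0). The resulting rule for \<open>nu\<close> is the one for the corner block in
  \<open>N_mat_mult\<close>.\<close>

lemma nu_mu_R:
  assumes E: "E \<in> set Es" and f: "f \<in> carrier R" and g: "g \<in> carrier R"
  shows "nu (f \<otimes>\<^bsub>R\<^esub> g) E = (lam f * nu g E + nu f E * mu g E) mod int p"
    "mu (f \<otimes>\<^bsub>R\<^esub> g) E = (mu f E * mu g E) mod int p"
    "nu (f \<oplus>\<^bsub>R\<^esub> g) E = (nu f E + nu g E) mod int p"
    "mu (f \<oplus>\<^bsub>R\<^esub> g) E = (mu f E + mu g E) mod int p"
proof -
  note B = Es_D(5)[OF E]
  have "base1 E \<in> carrier G" using Es_D(6)[OF E] cover_mem_carrier eleD(1)[OF Es_D(1)[OF E]] by blast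
  then have "f (base1 E) = comb (base1 E) (base2 E) (lam f) 0"
    by (simp add: base1_apply[OF E f] comb_def)
  then have b1: "crd1 (base1 E) (base2 E) (f (base1 E)) = lam f" "crd2 (base1 E) (base2 E) (f (base1 E)) = 0"
    using lam_bounds[OF f] by (simp_all add: crd_comb[OF B])
  note c = crd_mult[OF B Es_D(1)[OF E] f g Es_D(7)[OF E]]
  show "nu (f \<otimes>\<^bsub>R\<^esub> g) E = (lam f * nu g E + nu f E * mu g E) mod int p"
    "mu (f \<otimes>\<^bsub>R\<^esub> g) E = (mu f E * mu g E) mod int p"
    using c(1,2) by (simp_all add: b1)
  show "nu (f \<oplus>\<^bsub>R\<^esub> g) E = (nu f E + nu g E) mod int p"
    "mu (f \<oplus>\<^bsub>R\<^esub> g) E = (mu f E + mu g E) mod int p" using c(3,4) .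
qed

lemma MC_R:
  assumes K: "K \<in> points" "M \<in> MC K" and f: "f \<in> carrier R" and g: "g \<in> carrier R"
  shows "expo M (f \<otimes>\<^bsub>R\<^esub> g) = (expo M f * expo M g) mod int (card M)"
    "expo M (f \<oplus>\<^bsub>R\<^esub> g) = (expo M f + expo M g) mod int (card M)"
  using expo_R(1,2)[OF MC_D(1)[OF K(2)] f endo_MC[OF K f] g endo_MC[OF K g]] .

text \<open>Excludes the modulus 1, so that the exponent of the identity map is 1.\<close>

lemma MC_card: "K \<in> points \<Longrightarrow> M \<in> MC K \<Longrightarrow> int (card M) > 1"
  using card_mono[OF subgroup_finite[OF MC_D(3)] MC_D(2), of M K] pointsD(2) p_pos by fastforce

lemma R_Lambda_at_expo:
  assumes K: "K \<in> set Ks" and f: "f \<in> carrier R"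
  shows "(\<lambda>M\<in>MC K. expo M f) \<in> R_Lambda_at G K (lam f)"
proof -
  note pK = Ks_points[OF K]
  have b: "expo M f \<in> {0..<int (card M)}" if "M \<in> MC K" for M
    using expo_bounds[OF MC_D(1)[OF that] endo_MC[OF pK that f]] by simp
  have e: "x [^] expo M f = f x" if "M \<in> MC K" "x \<in> M" for M x
    using expo_apply[OF pK that(1) f that(2)] by simp
  have l: "x [^] lam f = f x" if "x \<in> K" for x
    using expo_point[OF pK f that] Ks_expo[OF K f] by simp
  show ?thesis using b MC_D(2) unfolding R_Lambda_at_def by (auto simp: e l subset_iff)
qed

lemma R_Lambda_expo: "K \<in> set Ks \<Longrightarrow> f \<in> carrier R \<Longrightarrow> (\<lambda>M\<in>MC K. expo M f) \<in> carrier (R_Lambda p G K)"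
  using R_Lambda_at_expo[of K f] lam_bounds[of f] by (auto simp: R_Lambda_def intro!: bexI[of _ "lam f"])

lemma coords_hom: "coords \<in> Ring.ring_hom R T"
proof (rule ring_hom_memI)
  \<comment> \<open>Writing the constant list as a map over \<open>Es\<close> makes the
    componentwise rules for products of lists applicable.\<close>
  have replicate: "replicate (length (map row Es)) (residue_ring (int p)) = map (\<lambda>_. residue_ring (int p)) Es"
    by (simp add: map_replicate_const)
  have p1: "1 < int p" using p_pos by simp
  have mu_c: "mu f E \<in> carrier (residue_ring (int p))" "nu f E \<in> carrier (residue_ring (int p))"
    if "E \<in> set Es" "f \<in> carrier R" for f E
    using crd(2-)[OF Es_D(5) base2_apply_closed] that by auto
  fix f g assume f: "f \<in> carrier R" and g: "g \<in> carrier R"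
  show "coords f \<in> carrier T"
  proof -
    have "set (map (nu f) Es) \<subseteq> carrier (residue_ring (int p))" "set (map (mu f) Es) \<subseteq> carrier (residue_ring (int p))"
      using mu_c f by auto
    moreover have "lam f \<in> carrier (residue_ring (int p))" using lam_bounds[OF f] by simp
    moreover have "map (\<lambda>K. \<lambda>M\<in>MC K. expo M f) Ks ! i \<in> R_Lambda_at G (Ks ! i) (lam f)" if "i < length Ks" for i
      using R_Lambda_at_expo f that by simp
    ultimately show ?thesis
      unfolding coords_def by (intro S_ring_memI) simp_all
  qed
  have "N_mat (length Ks) (map row Es) (lam (f \<otimes>\<^bsub>R\<^esub> g)) (map (nu (f \<otimes>\<^bsub>R\<^esub> g)) Es) (map (mu (f \<otimes>\<^bsub>R\<^esub> g)) Es) =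
     map_mat (\<lambda>x. x mod int p) (N_mat (length Ks) (map row Es) (lam f) (map (nu f) Es) (map (mu f) Es) *
       N_mat (length Ks) (map row Es) (lam g) (map (nu g) Es) (map (mu g) Es))"
    unfolding N_mat_mult
    by (subst N_mat_map) (simp_all add: lam_R[OF f g] nu_mu_R[OF _ f g] comp_def cong: map_cong)
  moreover have "map (\<lambda>K. \<lambda>M\<in>MC K. expo M (f \<otimes>\<^bsub>R\<^esub> g)) Ks =
      map (\<lambda>K. \<lambda>M\<in>MC K. expo M f) Ks \<otimes>\<^bsub>RDirProd_list (map (R_Lambda p G) Ks)\<^esub> map (\<lambda>K. \<lambda>M\<in>MC K. expo M g) Ks"
    by (subst RDirProd_list_mult)
      (auto simp: R_Lambda_expo f g R_Lambda_mult R_Lambda_add MC_R[OF Ks_points _ f g] intro!: restrict_ext)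
  moreover have "map (mu (f \<otimes>\<^bsub>R\<^esub> g)) Es = map (mu f) Es \<otimes>\<^bsub>RDirProd_list (map (\<lambda>_. residue_ring (int p)) Es)\<^esub> map (mu g) Es"
    by (subst RDirProd_list_mult) (use mu_c f g in \<open>auto simp: nu_mu_R[OF _ f g]\<close>)
  ultimately show "coords (f \<otimes>\<^bsub>R\<^esub> g) = coords f \<otimes>\<^bsub>T\<^esub> coords g"
    unfolding coords_def S_ring_mult replicate
    by (subst matrix_ring_mult[OF p1]) (simp_all only: length_map N_mat_carrier[of _ "map row Es", unfolded length_map])
  have "N_mat (length Ks) (map row Es) (lam (f \<oplus>\<^bsub>R\<^esub> g)) (map (nu (f \<oplus>\<^bsub>R\<^esub> g)) Es) (map (mu (f \<oplus>\<^bsub>R\<^esub> g)) Es) =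
     map_mat (\<lambda>x. x mod int p) (N_mat (length Ks) (map row Es) (lam f) (map (nu f) Es) (map (mu f) Es) +
       N_mat (length Ks) (map row Es) (lam g) (map (nu g) Es) (map (mu g) Es))"
    unfolding N_mat_add
    by (subst N_mat_map) (simp_all add: lam_R[OF f g] nu_mu_R[OF _ f g] comp_def cong: map_cong)
  moreover have "map (\<lambda>K. \<lambda>M\<in>MC K. expo M (f \<oplus>\<^bsub>R\<^esub> g)) Ks =
      map (\<lambda>K. \<lambda>M\<in>MC K. expo M f) Ks \<oplus>\<^bsub>RDirProd_list (map (R_Lambda p G) Ks)\<^esub> map (\<lambda>K. \<lambda>M\<in>MC K. expo M g) Ks"
    by (subst RDirProd_list_add)
      (auto simp: R_Lambda_expo f g R_Lambda_mult R_Lambda_add MC_R[OF Ks_points _ f g] intro!: restrict_ext)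
  moreover have "map (mu (f \<oplus>\<^bsub>R\<^esub> g)) Es = map (mu f) Es \<oplus>\<^bsub>RDirProd_list (map (\<lambda>_. residue_ring (int p)) Es)\<^esub> map (mu g) Es"
    by (subst RDirProd_list_add) (use mu_c f g in \<open>auto simp: nu_mu_R[OF _ f g]\<close>)
  ultimately show "coords (f \<oplus>\<^bsub>R\<^esub> g) = coords f \<oplus>\<^bsub>T\<^esub> coords g"
    unfolding coords_def S_ring_add replicate
    by (subst matrix_ring_add) (simp_all only: length_map N_mat_carrier[of _ "map row Es", unfolded length_map])
next
  interpret R: ring R by (rule R_ring)
  have replicate: "replicate (length (map row Es)) (residue_ring (int p)) = map (\<lambda>_. residue_ring (int p)) Es"
    by (simp add: map_replicate_const)
  have e: "expo M \<one>\<^bsub>R\<^esub> = 1" if "K \<in> points" "M \<in> MC K" for K M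
    using expo_R(3)[OF MC_D(1)[OF that(2)] R.one_closed endo_MC[OF that R.one_closed] R.one_closed endo_MC[OF that R.one_closed]]
      MC_card[OF that] by simp
  have l: "lam \<one>\<^bsub>R\<^esub> = 1"
    using expo_R(3)[OF points_cyclic[OF K0] R.one_closed endo_point[OF K0 R.one_closed] R.one_closed endo_point[OF K0 R.one_closed]]
      pointsD(2)[OF K0] p_pos by simp
  have nm: "nu \<one>\<^bsub>R\<^esub> E = 0" "mu \<one>\<^bsub>R\<^esub> E = 1" if E: "E \<in> set Es" for E
  proof -
    have "\<one>\<^bsub>R\<^esub> (base2 E) = comb (base1 E) (base2 E) 0 1"
      using basis_comb(2)[OF Es_D(5)[OF E]] cover_mem_carrier[OF eleD(1)[OF Es_D(1)[OF E]] Es_D(7)[OF E]]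
      by (simp add: R_apply)
    then show "nu \<one>\<^bsub>R\<^esub> E = 0" "mu \<one>\<^bsub>R\<^esub> E = 1" using p_pos by (simp_all add: crd_comb[OF Es_D(5)[OF E]])
  qed
  have "N_mat (length Ks) (map row Es) (lam \<one>\<^bsub>R\<^esub>) (map (nu \<one>\<^bsub>R\<^esub>) Es) (map (mu \<one>\<^bsub>R\<^esub>) Es) =
      1\<^sub>m (length Ks + length (map row Es))"
    using N_mat_one[of "length Ks" "map row Es"] by (simp add: l nm comp_def cong: map_cong)
  moreover have "map (\<lambda>K. \<lambda>M\<in>MC K. expo M \<one>\<^bsub>R\<^esub>) Ks = \<one>\<^bsub>RDirProd_list (map (R_Lambda p G) Ks)\<^esub>"
    unfolding RDirProd_list_one_map by (auto simp: R_Lambda_one e[OF Ks_points] intro!: restrict_ext)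
  moreover have "map (mu \<one>\<^bsub>R\<^esub>) Es = \<one>\<^bsub>RDirProd_list (map (\<lambda>_. residue_ring (int p)) Es)\<^esub>"
    unfolding RDirProd_list_one_map by (simp add: nm)
  ultimately show "coords \<one>\<^bsub>R\<^esub> = \<one>\<^bsub>T\<^esub>"
    unfolding coords_def S_ring_one replicate by simp
qed

lemma coords_eq_iff:
  assumes f: "f \<in> carrier R" and g: "g \<in> carrier R"
  shows "coords f = coords g \<longleftrightarrow> (\<forall>x\<in>supp (cls K0). f x = g x)"
proof
  assume eq: "coords f = coords g"
  let ?N = "\<lambda>f. N_mat (length Ks) (map row Es) (lam f) (map (nu f) Es) (map (mu f) Es)"
  have N: "?N f = ?N g" and X: "map (\<lambda>K. \<lambda>M\<in>MC K. expo M f) Ks = map (\<lambda>K. \<lambda>M\<in>MC K. expo M g) Ks"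
    and m: "map (mu f) Es = map (mu g) Es" using eq by (simp_all add: coords_def)
  \<comment> \<open>The top left entry exists because the class contains \<open>K0\<close>, so the
    scalar block is nonempty.\<close>
  have l: "lam f = lam g"
    using arg_cong[OF N, of "\<lambda>A. A $$ (0, 0)"] K0_Ks by (simp add: N_mat_index)
  \<comment> \<open>The only entry of column j in the corner block that can be nonzero sits in the
    row of the point of \<open>Es ! j\<close>.\<close>
  have n: "nu f (Es ! j) = nu g (Es ! j)" if j: "j < length Es" for j
    using arg_cong[OF N, of "\<lambda>A. A $$ (pos (pt (Es ! j)), length Ks + j)"] pos[OF Es_D(3), of "Es ! j"] j
    by (simp add: N_mat_index)
  show "\<forall>x\<in>supp (cls K0). f x = g x"
  proof
    fix x assume "x \<in> supp (cls K0)"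
    then consider K M where "K \<in> set Ks" "M \<in> MC K" "x \<in> M" | E where "E \<in> set Es" "x \<in> E"
      using Es Ks by (auto simp: supp_def)
    then show "f x = g x"
    proof cases
      case 1
      have "(\<lambda>M\<in>MC K. expo M f) M = (\<lambda>M\<in>MC K. expo M g) M" using X 1 by (auto simp: map_eq_conv)
      then have "expo M f = expo M g" using 1 by simp
      then show ?thesis
        using expo_apply[OF Ks_points[OF 1(1)] 1(2) f 1(3)] expo_apply[OF Ks_points[OF 1(1)] 1(2) g 1(3)] by simp
    next
      case 2
      have "nu f E = nu g E" using n 2 by (metis in_set_conv_nth)
      moreover have "mu f E = mu g E" using m 2 by (auto simp: map_eq_conv)
      ultimately have "f (base2 E) = g (base2 E)"
        using crd_eqI[OF Es_D(5)[OF 2(1)] base2_apply_closed[OF 2(1) f] base2_apply_closed[OF 2(1) g]] by simp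
      moreover have "f (base1 E) = g (base1 E)" using base1_apply[OF 2(1) f] base1_apply[OF 2(1) g] l by simp
      ultimately show ?thesis using basis_eq_on[OF Es_D(5)[OF 2(1)] Es_D(1)[OF 2(1)] f g _ _ 2(2)] by simp
    qed
  qed
next
  assume eq: "\<forall>x\<in>supp (cls K0). f x = g x"
  have M: "expo M f = expo M g" if "K \<in> set Ks" "M \<in> MC K" for K M
    using eq that Ks by (intro expo_cong) (auto simp: supp_def)
  \<comment> \<open>Any maximal cyclic subgroup above \<open>K0\<close> places \<open>K0\<close> in
    the support, so the values there determine \<open>lam\<close>.\<close>
  obtain M0 where "M0 \<in> MC K0" using MC_nonempty K0 by blast
  then have "K0 \<subseteq> supp (cls K0)" using MC_D(2) cls_refl by (fastforce simp: supp_def)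
  then have l: "lam f = lam g" using eq by (intro expo_cong) auto
  have E: "f (base2 E) = g (base2 E)" if "E \<in> set Es" for E
  proof -
    have "E \<in> {E \<in> ele. \<exists>K\<in>cls K0. pts E = {K}}" using that Es(1) by simp
    then have "base2 E \<in> supp (cls K0)" unfolding supp_def using Es_D(7)[OF that] by (intro UnI2 UnionI)
    then show ?thesis using eq by blast
  qed
  have X: "map (\<lambda>K. \<lambda>M\<in>MC K. expo M f) Ks = map (\<lambda>K. \<lambda>M\<in>MC K. expo M g) Ks"
    using M by (auto intro!: restrict_ext)
  show "coords f = coords g" unfolding coords_def X using E l by (simp cong: map_cong)
qed

text \<open>The array is realised on the given class and every other class receives zero data. Both
  choices are constant along \<open>linked\<close>, so \<open>construct\<close> applies and f is
  trivial on the other supports.\<close>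

lemma coords_onto:
  assumes y: "y \<in> carrier T"
  shows "\<exists>f\<in>carrier R. coords f = y \<and> (\<forall>Y\<in>comps - {supp (cls K0)}. \<forall>x\<in>Y. f x = \<one>)"
proof -
  obtain l \<nu> \<mu> xs where y_eq: "y = (N_mat (length Ks) (map row Es) l \<nu> \<mu>, xs, \<mu>)"
    and l: "0 \<le> l" "l < int p"
    and \<nu>: "length \<nu> = length Es" "set \<nu> \<subseteq> {0..<int p}"
    and \<mu>: "length \<mu> = length Es" "set \<mu> \<subseteq> {0..<int p}"
    and xs: "length xs = length Ks" "\<And>i. i < length Ks \<Longrightarrow> xs ! i \<in> R_Lambda_at G (Ks ! i) l"
    using y unfolding S_ring_carrier by auto
  define lK where "lK K = (if K \<in> set Ks then l else 0)" for K
  \<comment> \<open>M contains a single subgroup of order p, so the point selected by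
    \<open>THE\<close> is unique.\<close>
  define u where "u M = (if \<exists>K\<in>set Ks. M \<in> MC K then (xs ! pos (THE K. K \<in> set Ks \<and> M \<in> MC K)) M else 0)" for M
  have xsK: "xs ! pos K \<in> R_Lambda_at G K l" if "K \<in> set Ks" for K using xs(2) pos[OF that] by metis
  have uK: "u M = (xs ! pos K) M" if "K \<in> set Ks" "M \<in> MC K" for K M
  proof -
    have "(THE K. K \<in> set Ks \<and> M \<in> MC K) = K"
      using that MC_point_unique Ks_points by (intro the_equality) auto
    then show ?thesis using that by (auto simp: u_def)
  qed
  have u0: "u M = 0" if "K \<in> points" "K \<notin> set Ks" "M \<in> MC K" for K M
    using that MC_point_unique Ks_points unfolding u_def by metis
  \<comment> \<open>The endomorphism of the plane with columns (l, 0) and (nu_j, mu_j).\<close>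
  have "\<forall>j. \<exists>w. j < length Es \<longrightarrow> endo_on (Es ! j) w \<and> w (base1 (Es ! j)) = base1 (Es ! j) [^] l \<and>
     w (base2 (Es ! j)) = comb (base1 (Es ! j)) (base2 (Es ! j)) (\<nu> ! j) (\<mu> ! j)"
  proof
    fix j
    show "\<exists>w. j < length Es \<longrightarrow> endo_on (Es ! j) w \<and> w (base1 (Es ! j)) = base1 (Es ! j) [^] l \<and>
       w (base2 (Es ! j)) = comb (base1 (Es ! j)) (base2 (Es ! j)) (\<nu> ! j) (\<mu> ! j)"
    proof (cases "j < length Es")
      case True
      then have "Es ! j \<in> set Es" by simp
      note D = Es_D[OF this]
      show ?thesis
        using ex_endo_on[OF D(5), of "base1 (Es ! j) [^] l"] comb_closed[OF eleD(2)[OF D(1)] D(6,7)]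
          subgroup_int_pow_closed[OF cover_subgroup[OF eleD(1)[OF D(1)]] D(6)] by blast
    qed simp
  qed
  then obtain w where w: "\<And>j. j < length Es \<Longrightarrow> endo_on (Es ! j) (w j)"
    "\<And>j. j < length Es \<Longrightarrow> w j (base1 (Es ! j)) = base1 (Es ! j) [^] l"
    "\<And>j. j < length Es \<Longrightarrow> w j (base2 (Es ! j)) = comb (base1 (Es ! j)) (base2 (Es ! j)) (\<nu> ! j) (\<mu> ! j)"
    by metis
  define v where "v E = (if E \<in> set Es then w (SOME j. j < length Es \<and> Es ! j = E) else (\<lambda>_. \<one>))" for E
  have vj: "v (Es ! j) = w j" if "j < length Es" for j
  proof -
    have "(SOME i. i < length Es \<and> Es ! i = Es ! j) = j"
      using that Es(2) by (intro some_equality) (auto simp: nth_eq_iff_index_eq)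
    then show ?thesis using that by (simp add: v_def)
  qed
  have v0: "v E = (\<lambda>_. \<one>)" if "E \<notin> set Es" for E using that by (simp add: v_def)
  have "\<exists>f\<in>carrier R. (\<forall>K\<in>points. \<forall>M\<in>MC K. \<forall>x\<in>M. f x = x [^] u M) \<and>
    (\<forall>E\<in>ele. card (pts E) \<le> 1 \<longrightarrow> (\<forall>x\<in>E. f x = v E x))"
  proof (rule construct[of lK])
    show "lK K = lK K'" if "(K, K') \<in> linked" for K K'
      using cls_linked[OF that] Ks by (simp add: lK_def)
    show "x [^] u M = x [^] lK K" if "K \<in> points" "M \<in> MC K" "x \<in> K" for K M x
      using uK[of K M] u0[OF that(1) _ that(2)] xsK[of K] that by (auto simp: lK_def R_Lambda_at_def)
    show "x [^] u M = x [^] u M'" if "K \<in> points" "M \<in> MC K" "M' \<in> MC K" "x \<in> M" "x \<in> M'" for K M M' x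
    proof (cases "K \<in> set Ks")
      case True
      have "\<forall>M\<in>MC K. \<forall>M'\<in>MC K. \<forall>g\<in>M \<inter> M'. g [^] (xs ! pos K) M = g [^] (xs ! pos K) M'"
        using xsK[OF True] unfolding R_Lambda_at_def by blast
      then show ?thesis unfolding uK[OF True that(2)] uK[OF True that(3)] using that by blast
    next
      case False
      then show ?thesis using u0[OF that(1) False] that by simp
    qed
    show "endo_on E (v E)" if "E \<in> ele" for E
    proof (cases "E \<in> set Es")
      case True
      then show ?thesis using vj w(1) by (metis in_set_conv_nth)
    next
      case False
      then show ?thesis using v0 endo_on_trivial[OF cover_subgroup[OF eleD(1)[OF that]]] by simp
    qed
    show "v E x = x [^] lK K" if E: "E \<in> ele" "pts E = {K}" and x: "x \<in> K" for E K x
    proof (cases "K \<in> set Ks")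
      case True
      then have "E \<in> set Es" using E Es Ks by auto
      then obtain j where j: "j < length Es" "E = Es ! j" by (metis in_set_conv_nth)
      have pt: "pt E = K" using E by (simp add: pt_def)
      then obtain i :: int where i: "x = base1 E [^] i"
        using point_elt[OF Ks_points[OF True] x] by (auto simp: base1_def)
      have b: "base1 E \<in> E" "base1 E \<in> carrier G" using Es_D(6)[OF \<open>E \<in> set Es\<close>] elabD(5) eleD(2)[OF E(1)] by auto
      have "v E x = w j (base1 E) [^] i"
        using endo_on_int_pow[OF cover_subgroup[OF eleD(1)[OF E(1)]] _ b(1)] w(1)[OF j(1)] vj[OF j(1)] i j by simp
      then show ?thesis using w(2)[OF j(1)] j i b True by (simp add: lK_def int_pow_pow mult.commute)
    next
      case False
      then have "E \<notin> set Es" using E Es Ks by auto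
      then show ?thesis using v0 False by (simp add: lK_def)
    qed
  qed
  then obtain f where f0: "f \<in> carrier R" "\<forall>K\<in>points. \<forall>M\<in>MC K. \<forall>x\<in>M. f x = x [^] u M"
    "\<forall>E\<in>ele. card (pts E) \<le> 1 \<longrightarrow> (\<forall>x\<in>E. f x = v E x)" by (elim bexE conjE) (rule that)
  have f: "f \<in> carrier R" "\<And>K M x. K \<in> points \<Longrightarrow> M \<in> MC K \<Longrightarrow> x \<in> M \<Longrightarrow> f x = x [^] u M"
    "\<And>E x. E \<in> ele \<Longrightarrow> card (pts E) \<le> 1 \<Longrightarrow> x \<in> E \<Longrightarrow> f x = v E x"
    using f0 by blast+
  have lam: "lam f = l"
  proof -
    \<comment> \<open>The tuple entry at any M above \<open>K0\<close> restricts to l on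
      \<open>K0\<close>, by the condition built into \<open>R_Lambda_at\<close>.\<close>
    obtain M where M: "M \<in> MC K0" using MC_nonempty K0 by blast
    have "\<forall>x\<in>K0. x [^] (xs ! pos K0) M = x [^] l"
      using xsK[OF K0_Ks(1)] M unfolding R_Lambda_at_def by blast
    then have "f x = x [^] l" if "x \<in> K0" for x
      using f(2)[OF K0 M, of x] MC_D(2)[OF M] uK[OF K0_Ks(1) M] that by auto
    then have "lam f = l mod int (card K0)" by (rule expo_eqI[OF points_cyclic[OF K0]])
    then show ?thesis using l pointsD(2)[OF K0] by simp
  qed
  have nm: "nu f (Es ! j) = \<nu> ! j \<and> mu f (Es ! j) = \<mu> ! j" if j: "j < length Es" for j
  proof -
    have E: "Es ! j \<in> set Es" using j by simp
    have "f (base2 (Es ! j)) = comb (base1 (Es ! j)) (base2 (Es ! j)) (\<nu> ! j) (\<mu> ! j)"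
      using f(3)[OF Es_D(1)[OF E] _ Es_D(7)[OF E]] Es_D(2)[OF E] vj[OF j] w(3)[OF j] by simp
    moreover have "\<nu> ! j \<in> {0..<int p}" "\<mu> ! j \<in> {0..<int p}" using j \<nu> \<mu> by (metis nth_mem subsetD)+
    ultimately show ?thesis by (simp add: crd_comb[OF Es_D(5)[OF E]])
  qed
  then have n: "map (nu f) Es = \<nu>" and m: "map (mu f) Es = \<mu>"
    using \<nu> \<mu> by (auto intro!: nth_equalityI)
  have X: "map (\<lambda>K. \<lambda>M\<in>MC K. expo M f) Ks = xs"
  proof (rule nth_equalityI)
    fix i assume "i < length (map (\<lambda>K. \<lambda>M\<in>MC K. expo M f) Ks)"
    then have i: "i < length Ks" by simp
    then have K: "Ks ! i \<in> set Ks" by simp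
    have mem: "xs ! i \<in> (\<Pi>\<^sub>E M\<in>MC (Ks ! i). {0..<int (card M)})" using xs(2)[OF i] by (simp add: R_Lambda_at_def)
    have "expo M f = (xs ! i) M" if M: "M \<in> MC (Ks ! i)" for M
    proof -
      have "expo M f = u M mod int (card M)"
        using f(2)[OF Ks_points[OF K] M] by (rule expo_eqI[OF MC_D(1)[OF M]])
      moreover have "u M = (xs ! i) M" using uK[OF K M] pos_nth[OF i] by simp
      moreover have "(xs ! i) M \<in> {0..<int (card M)}" using mem M by (rule PiE_mem)
      ultimately show ?thesis by simp
    qed
    then have "(\<lambda>M\<in>MC (Ks ! i). expo M f) = xs ! i"
      using mem by (intro extensionalityI[of _ "MC (Ks ! i)"]) (auto simp: PiE_def)
    then show "map (\<lambda>K. \<lambda>M\<in>MC K. expo M f) Ks ! i = xs ! i" using i by simp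
  qed (simp add: xs)
  have "coords f = y" unfolding coords_def y_eq X n m lam ..
  moreover have "f x = \<one>" if Y: "Y \<in> comps - {supp (cls K0)}" "x \<in> Y" for Y x
  proof (cases "Y \<in> ele \<and> pts Y = {}")
    case True
    then have "Y \<notin> set Es" using Es_D(2) by auto
    then show ?thesis using f(3)[of Y x] True Y v0 by simp
  next
    case False
    then obtain K where K: "K \<in> points" "Y = supp (cls K)" using Y by (auto simp: comps_def)
    \<comment> \<open>A class that met \<open>Ks\<close> would be the class of \<open>K0\<close>,
      and its support would be the excluded one.\<close>
    have disj: "K' \<notin> set Ks" if "K' \<in> cls K" for K'
      using that K Y Ks cls_eq by (metis DiffE insertCI)
    from Y(2)[unfolded K(2)] consider K' M where "K' \<in> cls K" "M \<in> MC K'" "x \<in> M"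
      | E K' where "E \<in> ele" "K' \<in> cls K" "pts E = {K'}" "x \<in> E"
      by (auto simp: supp_def)
    then show ?thesis
    proof cases
      case 1
      then have "K' \<in> points" using cls_points[OF K(1)] by blast
      then show ?thesis using f(2)[OF _ 1(2,3)] u0[OF _ disj[OF 1(1)] 1(2)] by simp
    next
      case 2
      then have "E \<notin> set Es" using disj[OF 2(2)] Es Ks by auto
      then show ?thesis using f(3)[OF 2(1) _ 2(4)] 2(3) v0 by simp
    qed
  qed
  ultimately show ?thesis using f(1) by blast
qed

lemma row_set: "set (map row Es) \<subseteq> {1..length Ks}"
  using pos[OF Es_D(3)] by (fastforce simp: Suc_le_eq)

lemma class_component:
  "\<exists>(F :: nat ring) k. ring F \<and> F \<simeq> T \<and> k \<in> Ring.ring_hom R F \<and>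
    (\<forall>f\<in>carrier R. k f = \<zero>\<^bsub>F\<^esub> \<longleftrightarrow> (\<forall>x\<in>supp (cls K0). f x = \<one>)) \<and>
    (\<forall>y\<in>carrier F. \<exists>f\<in>carrier R. k f = y \<and> (\<forall>Y'\<in>comps - {supp (cls K0)}. \<forall>x\<in>Y'. f x = \<one>))"
  using coords_hom
proof (rule component_from_hom)
qed (fact coords_eq_iff coords_onto supp_carrier)+

end

text \<open>Finiteness supplies the enumerations of the class and of its one-point planes that were
  fixed above.\<close>

lemma class_component_ex:
  assumes "K0 \<in> points"
  shows "\<exists>(F :: nat ring) k idx Ks. length Ks > 0 \<and> set idx \<subseteq> {1..length Ks} \<and> set Ks \<subseteq> points \<and>
    ring F \<and> F \<simeq> S_ring p G idx Ks \<and> k \<in> Ring.ring_hom R F \<and>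
    (\<forall>f\<in>carrier R. k f = \<zero>\<^bsub>F\<^esub> \<longleftrightarrow> (\<forall>x\<in>supp (cls K0). f x = \<one>)) \<and>
    (\<forall>y\<in>carrier F. \<exists>f\<in>carrier R. k f = y \<and> (\<forall>Y'\<in>comps - {supp (cls K0)}. \<forall>x\<in>Y'. f x = \<one>))"
proof -
  have "finite (cls K0)" using cls_points[OF assms] points_finite finite_subset by blast
  then obtain Ks where Ks: "set Ks = cls K0" "distinct Ks" using finite_distinct_list by blast
  have "ele \<subseteq> Pow (carrier G)" using ele_carrier by blast
  then have "finite {E \<in> ele. \<exists>K\<in>cls K0. pts E = {K}}" using fin by (simp add: finite_subset)
  from finite_distinct_list[OF this]
  obtain Es where Es: "set Es = {E \<in> ele. \<exists>K\<in>cls K0. pts E = {K}}" "distinct Es" by blast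
  note ctxt = assms Ks Es
  have sub: "set Ks \<subseteq> points" using Ks cls_points[OF assms] by simp
  show ?thesis
    using class_component[OF ctxt] by (elim exE conjE, intro exI conjI) (rule K0_Ks(2)[OF ctxt] row_set[OF ctxt] sub | assumption)+
qed

end

section \<open>Assembling the components\<close>

theorem theorem3p7:
  fixes p :: nat and G :: "('a, 'b) monoid_scheme" and \<C> :: "'a set set"
  assumes "prime p"
    and "finite_p_group p G"
    and "star_covering p G \<C>"
  shows "\<exists>Fs :: nat ring list.
    cover_ring G \<C> \<simeq> RDirProd_list Fs \<and>
    (\<forall>F\<in>set Fs. ring F \<and>
      (F \<simeq> matrix_ring (residue_ring p) 2 \<or>
       (\<exists>(m::nat) (n::nat) idx Ks.
          m > 0 \<and> length idx = n \<and> set idx \<subseteq> {1..m} \<and>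
          length Ks = m \<and> (\<forall>K\<in>set Ks. subgroup K G \<and> card K = p) \<and>
          F \<simeq> S_ring p G idx Ks)))"
proof -
  obtain e where e: "order G = p ^ e" using assms(2) by (auto simp: finite_p_group_def)
  interpret group G using assms(2) by (simp add: finite_p_group_def)
  interpret star_cover G p e \<C>
    using assms e by unfold_locales (auto simp: finite_p_group_def)
  let ?shape = "\<lambda>F. F \<simeq> matrix_ring (residue_ring (int p)) 2 \<or>
       (\<exists>(m::nat) (n::nat) idx Ks.
          m > 0 \<and> length idx = n \<and> set idx \<subseteq> {1..m} \<and>
          length Ks = m \<and> (\<forall>K\<in>set Ks. subgroup K G \<and> card K = p) \<and>
          F \<simeq> S_ring p G idx Ks)"
  \<comment> \<open>Besides the shape of the factor, this collects what the product criterion needs: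
    the kernel consists of the functions trivial on Y, and every value has a preimage trivial on the
    other supports.\<close>
  define good where "good Y F k \<longleftrightarrow> ring F \<and> ?shape F \<and> k \<in> Ring.ring_hom R F \<and>
    (\<forall>f\<in>carrier R. k f = \<zero>\<^bsub>F\<^esub> \<longleftrightarrow> (\<forall>x\<in>Y. f x = \<one>\<^bsub>G\<^esub>)) \<and>
    (\<forall>y\<in>carrier F. \<exists>f\<in>carrier R. k f = y \<and> (\<forall>Y'\<in>comps - {Y}. \<forall>x\<in>Y'. f x = \<one>\<^bsub>G\<^esub>))"
    for Y and F :: "nat ring" and k
  have "\<exists>F k. good Y F k" if Y: "Y \<in> comps" for Y
  proof (cases "Y \<in> ele \<and> pts Y = {}")
    case True
    then obtain F :: "nat ring" and k where
      "ring F" "F \<simeq> matrix_ring (residue_ring (int p)) 2" "k \<in> Ring.ring_hom R F"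
      "\<forall>f\<in>carrier R. k f = \<zero>\<^bsub>F\<^esub> \<longleftrightarrow> (\<forall>x\<in>Y. f x = \<one>\<^bsub>G\<^esub>)"
      "\<forall>y\<in>carrier F. \<exists>f\<in>carrier R. k f = y \<and> (\<forall>Y'\<in>comps - {Y}. \<forall>x\<in>Y'. f x = \<one>\<^bsub>G\<^esub>)"
      using free_component[of Y] by blast
    then show ?thesis unfolding good_def by (intro exI[of _ F] exI[of _ k] conjI disjI1)
  next
    case False
    then obtain K where K: "K \<in> points" "Y = supp (cls K)" using Y by (auto simp: comps_def)
    obtain F :: "nat ring" and k idx Ks where F: "length Ks > 0" "set idx \<subseteq> {1..length Ks}" "set Ks \<subseteq> points"
      "ring F" "F \<simeq> S_ring p G idx Ks" "k \<in> Ring.ring_hom R F"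
      "\<forall>f\<in>carrier R. k f = \<zero>\<^bsub>F\<^esub> \<longleftrightarrow> (\<forall>x\<in>Y. f x = \<one>\<^bsub>G\<^esub>)"
      "\<forall>y\<in>carrier F. \<exists>f\<in>carrier R. k f = y \<and> (\<forall>Y'\<in>comps - {Y}. \<forall>x\<in>Y'. f x = \<one>\<^bsub>G\<^esub>)"
      using class_component_ex[OF K(1), folded K(2)] by (elim exE conjE) (rule that)
    have "?shape F" using F(1-3,5) pointsD by blast
    then show ?thesis using F(4,6-8) unfolding good_def by (intro exI[of _ F] exI[of _ k] conjI)
  qed
  then obtain F k where "\<And>Y. Y \<in> comps \<Longrightarrow> good Y (F Y) (k Y)" by metis
  note F = this[unfolded good_def]
  have "comps \<subseteq> Pow (carrier G)"
    using supp_carrier ele_carrier by (auto simp: comps_def)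
  then have "finite comps" using fin by (simp add: finite_subset)
  then have "\<exists>Fs. set Fs = F ` comps \<and> R \<simeq> RDirProd_list Fs"
  proof (rule ring_iso_RDirProd_list[OF R_ring, where h = k])
    fix f assume "f \<in> carrier R" "\<And>Y. Y \<in> comps \<Longrightarrow> k Y f = \<zero>\<^bsub>F Y\<^esub>"
    then show "f = \<zero>\<^bsub>R\<^esub>" using F supp_cover by meson
  next
    fix Y y assume Y: "Y \<in> comps" "y \<in> carrier (F Y)"
    then obtain f where "f \<in> carrier R" "k Y f = y" "\<forall>Y'\<in>comps - {Y}. \<forall>x\<in>Y'. f x = \<one>\<^bsub>G\<^esub>"
      using F[OF Y(1)] by blast
    moreover from this have "k Y' f = \<zero>\<^bsub>F Y'\<^esub>" if "Y' \<in> comps - {Y}" for Y'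
      using F[of Y'] that by blast
    ultimately show "\<exists>f\<in>carrier R. k Y f = y \<and> (\<forall>Y'\<in>comps - {Y}. k Y' f = \<zero>\<^bsub>F Y'\<^esub>)" by blast
  qed (use F in blast)+
  then obtain Fs where Fs: "set Fs = F ` comps" "R \<simeq> RDirProd_list Fs" by blast
  then show ?thesis using F by (intro exI[of _ Fs]) (auto simp del: One_nat_def)
qed

end
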